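(* Let $n\geq 3$ be a natural number, $R$ a commutative ring and $H$ a subgroup of $O_{2n}(R)$. Then $H$ is normalized by $EO_{2n}(R)$ if and only if $$EO_{2n}(R,I)\subseteq H\subseteq CO_{2n}(R,I)$$ for some ideal $I$ of $R$.
   Context: Rings are associative with $1\neq 0$. Let $\Omega:=\{1,\dots,n,-n,\dots,-1\}$. Rows and columns of $2n\times 2n$ matrices and coordinates of columns in $V:=R^{2n}$ are indexed by $\Omega$ in the order $1,\dots,n,-n,\dots,-1$ (so for $-n\leq i\leq -1$ the index $i$ refers to position $2n+1+i$). Let $p\in M_n(R)$ be the matrix with ones on the skew diagonal and zeros elsewhere, and let $q:V\to R$, $q(v)=v^t\begin{pmatrix}0&p\\0&0\end{pmatrix}v$. The even-dimensional orthogonal group is $O_{2n}(R):=\{\sigma\in GL_{2n}(R)\mid q(\sigma v)=q(v)\ \forall v\in V\}$. Let $e$ be the identity matrix and $e^{ij}$ ($i,j\in\Omega$) the matrix with $1$ at position $(i,j)$ and zeros elsewhere. For $i,j\in\Omega$ with $i\neq\pm j$ and $x\in R$, the elementary orthogonal transvection is $T_{ij}(x):=e+xe^{ij}-xe^{-j,-i}\in O_{2n}(R)$. $EO_{2n}(R)$ is the subgroup of $O_{2n}(R)$ generated by all elementary orthogonal transvections. For an ideal $I$ of $R$, $EO_{2n}(I)$ is the subgroup generated by all $T_{ij}(x)$ with $i\neq\pm j$ and $x\in I$, and $EO_{2n}(R,I)$ is the normal closure of $EO_{2n}(I)$ in $EO_{2n}(R)$. $CO_{2n}(R,I)$ (the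 full congruence subgroup of level $I$) is the preimage of the center of $O_{2n}(R/I)$ under the group homomorphism $O_{2n}(R)\to O_{2n}(R/I)$ induced by the canonical map $R\to R/I$; the ideal $I=R$ is allowed, in which case $O_{2n}(R/I)$ is the trivial group and $CO_{2n}(R,R)=O_{2n}(R)$. *)

theory Defs
  imports "HOL-Algebra.QuotRing" "HOL-Algebra.Group_Action" "HOL-Algebra.Generated_Groups"
begin

text \<open>
  Index sets are subsets of \<^typ>\<open>int\<close>. Matrices and column vectors are extensional functions,
  so that equality of matrices is equality of their entries.
\<close>

definition mat_ring :: "('a, 'b) ring_scheme \<Rightarrow> int set \<Rightarrow> (int \<times> int \<Rightarrow> 'a) ring" where
  "mat_ring R S =
    \<lparr>carrier = (S \<times> S) \<rightarrow>\<^sub>E carrier R,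
     mult = (\<lambda>A B. \<lambda>(i, j) \<in> S \<times> S. \<Oplus>\<^bsub>R\<^esub>k\<in>S. A (i, k) \<otimes>\<^bsub>R\<^esub> B (k, j)),
     one = (\<lambda>(i, j) \<in> S \<times> S. if i = j then \<one>\<^bsub>R\<^esub> else \<zero>\<^bsub>R\<^esub>),
     zero = (\<lambda>(i, j) \<in> S \<times> S. \<zero>\<^bsub>R\<^esub>),
     add = (\<lambda>A B. \<lambda>(i, j) \<in> S \<times> S. A (i, j) \<oplus>\<^bsub>R\<^esub> B (i, j))\<rparr>"

definition mat_vec :: "('a, 'b) ring_scheme \<Rightarrow> int set \<Rightarrow> (int \<times> int \<Rightarrow> 'a) \<Rightarrow> (int \<Rightarrow> 'a) \<Rightarrow> int \<Rightarrow> 'a" where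
  "mat_vec R S A v = (\<lambda>i\<in>S. \<Oplus>\<^bsub>R\<^esub>k\<in>S. A (i, k) \<otimes>\<^bsub>R\<^esub> v k)"

definition map_mat :: "int set \<Rightarrow> ('a \<Rightarrow> 'c) \<Rightarrow> (int \<times> int \<Rightarrow> 'a) \<Rightarrow> int \<times> int \<Rightarrow> 'c" where
  "map_mat S f A = (\<lambda>(i, j) \<in> S \<times> S. f (A (i, j)))"

definition GL :: "('a, 'b) ring_scheme \<Rightarrow> int set \<Rightarrow> (int \<times> int \<Rightarrow> 'a) monoid" where
  "GL R S = units_of (mat_ring R S)"

definition Omega :: "nat \<Rightarrow> int set" where
  "Omega n = {1..int n} \<union> {- int n..-1}"

text \<open>The position of an index in the order \<open>1, ..., n, -n, ..., -1\<close>.\<close>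

definition pos :: "nat \<Rightarrow> int \<Rightarrow> int" where
  "pos n i = (if 0 < i then i else 2 * int n + 1 + i)"

definition skew_id :: "('a, 'b) ring_scheme \<Rightarrow> nat \<Rightarrow> int \<times> int \<Rightarrow> 'a" where
  "skew_id R n = (\<lambda>(r, c) \<in> {1..int n} \<times> {1..int n}. if r + c = int n + 1 then \<one>\<^bsub>R\<^esub> else \<zero>\<^bsub>R\<^esub>)"

text \<open>The block matrix whose upper right block is \<^const>\<open>skew_id\<close>; the other blocks vanish.\<close>

definition form_mat :: "('a, 'b) ring_scheme \<Rightarrow> nat \<Rightarrow> int \<times> int \<Rightarrow> 'a" where
  "form_mat R n = (\<lambda>(i, j) \<in> Omega n \<times> Omega n.
     if pos n i \<le> int n \<and> int n < pos n j then skew_id R n (pos n i, pos n j - int n) else \<zero>\<^bsub>R\<^esub>)"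

definition quad_form :: "('a, 'b) ring_scheme \<Rightarrow> nat \<Rightarrow> (int \<Rightarrow> 'a) \<Rightarrow> 'a" where
  "quad_form R n v = (\<Oplus>\<^bsub>R\<^esub>i\<in>Omega n. v i \<otimes>\<^bsub>R\<^esub> mat_vec R (Omega n) (form_mat R n) v i)"

definition orth_group :: "('a, 'b) ring_scheme \<Rightarrow> nat \<Rightarrow> (int \<times> int \<Rightarrow> 'a) monoid" where
  "orth_group R n = (GL R (Omega n))\<lparr>carrier :=
     {\<sigma> \<in> carrier (GL R (Omega n)).
        \<forall>v \<in> Omega n \<rightarrow>\<^sub>E carrier R. quad_form R n (mat_vec R (Omega n) \<sigma> v) = quad_form R n v}\<rparr>"

text \<open>\<open>unit_mat R n x i j\<close> is \<open>x e\<^bsup>ij\<^esup>\<close>.\<close>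

definition unit_mat :: "('a, 'b) ring_scheme \<Rightarrow> nat \<Rightarrow> 'a \<Rightarrow> int \<Rightarrow> int \<Rightarrow> int \<times> int \<Rightarrow> 'a" where
  "unit_mat R n x i j = (\<lambda>(k, l) \<in> Omega n \<times> Omega n. if k = i \<and> l = j then x else \<zero>\<^bsub>R\<^esub>)"

definition transv :: "('a, 'b) ring_scheme \<Rightarrow> nat \<Rightarrow> int \<Rightarrow> int \<Rightarrow> 'a \<Rightarrow> int \<times> int \<Rightarrow> 'a" where
  "transv R n i j x =
     \<one>\<^bsub>mat_ring R (Omega n)\<^esub> \<oplus>\<^bsub>mat_ring R (Omega n)\<^esub> unit_mat R n x i j
       \<ominus>\<^bsub>mat_ring R (Omega n)\<^esub> unit_mat R n x (- j) (- i)"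

definition EO_ideal :: "('a, 'b) ring_scheme \<Rightarrow> nat \<Rightarrow> 'a set \<Rightarrow> (int \<times> int \<Rightarrow> 'a) set" where
  "EO_ideal R n I = generate (orth_group R n)
     {transv R n i j x | i j x. i \<in> Omega n \<and> j \<in> Omega n \<and> i \<noteq> j \<and> i \<noteq> - j \<and> x \<in> I}"

definition EO :: "('a, 'b) ring_scheme \<Rightarrow> nat \<Rightarrow> (int \<times> int \<Rightarrow> 'a) set" where
  "EO R n = EO_ideal R n (carrier R)"

definition normal_closure :: "('g, 'b) monoid_scheme \<Rightarrow> 'g set \<Rightarrow> 'g set" where
  "normal_closure G A = \<Inter> {N. N \<lhd> G \<and> A \<subseteq> N}"

definition EO_rel :: "('a, 'b) ring_scheme \<Rightarrow> nat \<Rightarrow> 'a set \<Rightarrow> (int \<times> int \<Rightarrow> 'a) set" where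
  "EO_rel R n I = normal_closure ((orth_group R n)\<lparr>carrier := EO R n\<rparr>) (EO_ideal R n I)"

definition center :: "('g, 'b) monoid_scheme \<Rightarrow> 'g set" where
  "center G = {z \<in> carrier G. \<forall>g \<in> carrier G. z \<otimes>\<^bsub>G\<^esub> g = g \<otimes>\<^bsub>G\<^esub> z}"

text \<open>For \<open>I = carrier R\<close>, the quotient is the zero ring, over which \<^const>\<open>orth_group\<close> is trivial.\<close>

definition CO :: "('a, 'b) ring_scheme \<Rightarrow> nat \<Rightarrow> 'a set \<Rightarrow> (int \<times> int \<Rightarrow> 'a) set" where
  "CO R n I = {\<sigma> \<in> carrier (orth_group R n).
     map_mat (Omega n) (\<lambda>x. I +>\<^bsub>R\<^esub> x) \<sigma> \<in> center (orth_group (R Quot I) n)}"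

end

theory Submission
  imports Defs
begin

text \<open>
  All computations take place with Eichler transformations \<open>E(u, v)\<close>, where \<open>u\<close> is isotropic and
  orthogonal to \<open>v\<close>: they are additive in \<open>v\<close>, satisfy \<open>\<sigma>E(u, v)\<sigma>\<^sup>-\<^sup>1 = E(\<sigma>u, \<sigma>v)\<close>, and the elementary
  transvections are the \<open>E(e\<^bsub>i\<^esub>, xe\<^bsub>j\<^esub>)\<close>.

  If \<open>u\<close> is moreover unimodular and \<open>v\<close> has entries in \<open>I\<close>, Suslin's trick of decomposing \<open>v\<close> into
  Koszul syzygies of \<open>u\<close> shows that \<open>E(u, v)\<close> lies in \<open>EO(R, I)\<close>. An element \<open>\<sigma>\<close> of \<open>CO(R, I)\<close> is
  congruent to a scalar \<open>\<lambda>\<close> with \<open>\<lambda>\<^sup>2 = 1\<close> modulo \<open>I\<close>, and comparing \<open>E(\<sigma>e\<^bsub>i\<^esub>, x\<sigma>e\<^bsub>j\<^esub>)\<close> with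
  \<open>E(\<lambda>e\<^bsub>i\<^esub>, x\<lambda>e\<^bsub>j\<^esub>)\<close> modulo \<open>EO(R, I)\<close> yields \<open>[CO(R, I), EO(R)] \<subseteq> EO(R, I)\<close>.

  Conversely, let \<open>\<sigma>\<close> lie in a subgroup \<open>H\<close> normalized by \<open>EO(R)\<close>. For a column \<open>u = \<sigma>e\<^bsub>j\<^esub>\<close> there is
  a unipotent \<open>\<tau>\<close> fixing \<open>u\<close> whose coefficients are coordinates of \<open>u\<close>, as in Preusser's proof. Then \<open>\<sigma>\<^sup>-\<^sup>1\<tau>\<sigma>\<close> fixes
  \<open>e\<^bsub>j\<^esub>\<close>, and two further commutators with elementary transvections extract the transvection
  with parameter \<open>\<sigma>\<^bsub>ij\<^esub>\<close>, up to sign.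
\<close>

subsection \<open>Finite sums and groups\<close>

lemma (in abelian_monoid) finsum_swap:
  assumes "finite A" "finite B" "\<And>a b. a \<in> A \<Longrightarrow> b \<in> B \<Longrightarrow> f a b \<in> carrier G"
  shows "(\<Oplus>a\<in>A. \<Oplus>b\<in>B. f a b) = (\<Oplus>b\<in>B. \<Oplus>a\<in>A. f a b)"
  using assms(1,3)
proof (induction A rule: finite_induct)
  case empty
  then show ?case using assms(2) by simp
next
  case (insert x A)
  have "(\<Oplus>b\<in>B. \<Oplus>a\<in>insert x A. f a b) = (\<Oplus>b\<in>B. f x b \<oplus> (\<Oplus>a\<in>A. f a b))"
    using insert by (intro finsum_cong') (auto simp: Pi_def intro!: finsum_insert)
  also have "\<dots> = (\<Oplus>b\<in>B. f x b) \<oplus> (\<Oplus>b\<in>B. \<Oplus>a\<in>A. f a b)"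
    using insert by (intro finsum_addf) auto
  finally show ?case using insert by (simp add: Pi_def)
qed

lemma (in abelian_monoid) finsum_delta:
  assumes "finite A" "i \<in> A" "f i \<in> carrier G"
  shows "(\<Oplus>k\<in>A. if k = i then f k else \<zero>) = f i"
proof -
  have "(\<Oplus>k\<in>A. if k = i then f k else \<zero>) = (\<Oplus>k\<in>A. if i = k then f i else \<zero>)"
    using assms by (intro finsum_cong') auto
  also have "\<dots> = f i" using add.finprod_singleton[of i A "\<lambda>_. f i"] assms by (simp add: Pi_def)
  finally show ?thesis .
qed

lemma (in abelian_monoid) finsum_all_zero:
  "(\<And>k. k \<in> A \<Longrightarrow> f k = \<zero>) \<Longrightarrow> (\<Oplus>k\<in>A. f k) = \<zero>"
  by (rule add.finprod_one_eqI)

section \<open>Normal closures, commutators and normalizers\<close>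

context group
begin

lemma normal_closure_normal:
  assumes "A \<subseteq> carrier G"
  shows "normal_closure G A \<lhd> G"
proof -
  \<comment> \<open>The whole group is one of the normal subgroups being intersected, which bounds
    the intersection by the carrier.\<close>
  have G: "carrier G \<lhd> G"
    unfolding normal_inv_iff using subgroup_self by auto
  have "subgroup (normal_closure G A) G"
  proof (rule subgroupI)
    show "normal_closure G A \<subseteq> carrier G" using G assms by (auto simp: normal_closure_def)
    have "\<one> \<in> normal_closure G A"
      by (auto simp: normal_closure_def normal_inv_iff subgroup.one_closed)
    then show "normal_closure G A \<noteq> {}" by blast
  qed (auto simp: normal_closure_def normal_inv_iff subgroup.m_inv_closed subgroup.m_closed)
  then show ?thesis
    unfolding normal_inv_iff by (auto simp: normal_closure_def normal_inv_iff)
qed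

text \<open>Grouped as \<open>A\<close> times a conjugate of \<open>inv A\<close>, a commutator
  needs only one of its two entries in \<open>N\<close>, as long as that conjugate returns to
  \<open>N\<close>.\<close>

lemma commutator_in:
  assumes "subgroup N G" "A \<in> N" "F \<in> carrier G" "F \<otimes> inv A \<otimes> inv F \<in> N"
  shows "A \<otimes> F \<otimes> inv A \<otimes> inv F \<in> N"
proof -
  have "A \<in> carrier G" by (rule subgroup.mem_carrier[OF assms(1,2)])
  then have "A \<otimes> F \<otimes> inv A \<otimes> inv F = A \<otimes> (F \<otimes> inv A \<otimes> inv F)"
    using assms(3) by (simp add: m_assoc)
  then show ?thesis using subgroup.m_closed[OF assms(1,2,4)] by simp
qed

lemma inv_cancel:
  assumes "x \<in> carrier G" "y \<in> carrier G"
  shows "inv x \<otimes> (x \<otimes> y) = y" "x \<otimes> (inv x \<otimes> y) = y"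
  using assms by (simp_all flip: m_assoc)

text \<open>The commutators agree modulo \<open>N\<close> because their quotient is a product of
  conjugates, by elements of \<open>E\<close>, of \<nu>, \<mu> and the inverses of \<nu> and \<mu>.
  Only conjugation by \<open>E\<close> has to preserve \<open>N\<close>; this fits EO(R, I), which
  is normal in EO(R) by construction.\<close>

lemma commutator_cong:
  assumes E: "subgroup E G" and N: "subgroup N G" "N \<subseteq> E"
    and nrm: "\<And>g x. g \<in> E \<Longrightarrow> x \<in> N \<Longrightarrow> g \<otimes> x \<otimes> inv g \<in> N"
    and AF: "A \<in> E" "F \<in> E" "\<nu> \<in> N" "\<mu> \<in> N"
  shows "(A \<otimes> \<nu>) \<otimes> (F \<otimes> \<mu>) \<otimes> inv (A \<otimes> \<nu>) \<otimes> inv (F \<otimes> \<mu>) \<otimes> inv (A \<otimes> F \<otimes> inv A \<otimes> inv F) \<in> N"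
proof -
  have c [simp]: "x \<in> carrier G" if "x \<in> E" for x using subgroup.mem_carrier[OF E that] .
  have NE [simp]: "x \<in> E" if "x \<in> N" for x using N(2) that by blast
  note [simp] = AF
  note cl = subgroup.m_closed[OF E] subgroup.m_inv_closed[OF E]
  let ?C = "A \<otimes> F \<otimes> inv A \<otimes> inv F"
  have C: "?C \<in> E" by (intro cl) simp_all
  have 1: "A \<otimes> \<nu> \<otimes> inv A \<in> N" by (intro nrm) simp_all
  have 2: "(A \<otimes> F) \<otimes> \<mu> \<otimes> inv (A \<otimes> F) \<in> N" by (intro nrm cl) simp_all
  have 3: "(A \<otimes> F) \<otimes> inv \<nu> \<otimes> inv (A \<otimes> F) \<in> N"
    by (intro nrm cl subgroup.m_inv_closed[OF N(1)]) simp_all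
  have 4: "(A \<otimes> F \<otimes> inv A) \<otimes> inv \<mu> \<otimes> inv (A \<otimes> F \<otimes> inv A) \<in> N"
    by (intro nrm cl subgroup.m_inv_closed[OF N(1)]) simp_all
  have "(A \<otimes> \<nu>) \<otimes> (F \<otimes> \<mu>) \<otimes> inv (A \<otimes> \<nu>) \<otimes> inv (F \<otimes> \<mu>) \<otimes> inv ?C =
     (A \<otimes> \<nu> \<otimes> inv A) \<otimes> ((A \<otimes> F) \<otimes> \<mu> \<otimes> inv (A \<otimes> F)) \<otimes> ((A \<otimes> F) \<otimes> inv \<nu> \<otimes> inv (A \<otimes> F)) \<otimes> ((A \<otimes> F \<otimes> inv A) \<otimes> inv \<mu> \<otimes> inv (A \<otimes> F \<otimes> inv A))"
    by (simp add: m_assoc inv_mult_group inv_cancel)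
  also have "\<dots> \<in> N" by (intro subgroup.m_closed[OF N(1)] 1 2 3 4)
  finally show ?thesis .
qed

lemma normalizer_iff:
  assumes H: "subgroup H G" and E: "subgroup E G"
  shows "E \<subseteq> normalizer G H \<longleftrightarrow> (\<forall>g\<in>E. \<forall>h\<in>H. g \<otimes> h \<otimes> inv g \<in> H)"
proof
  have HG: "H \<subseteq> carrier G" using H by (rule subgroup.subset)
  have conj_set: "g <# H #> inv g = (\<lambda>h. g \<otimes> h \<otimes> inv g) ` H" for g
    by (auto simp: l_coset_def r_coset_def)
  show "\<forall>g\<in>E. \<forall>h\<in>H. g \<otimes> h \<otimes> inv g \<in> H" if "E \<subseteq> normalizer G H"
  proof (intro ballI)
    fix g h assume g: "g \<in> E" and h: "h \<in> H"
    have "g <# H #> inv g = H" using that g HG by (auto simp: normalizer_def stabilizer_def)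
    then show "g \<otimes> h \<otimes> inv g \<in> H" using h unfolding conj_set by blast
  qed
  assume conj: "\<forall>g\<in>E. \<forall>h\<in>H. g \<otimes> h \<otimes> inv g \<in> H"
  show "E \<subseteq> normalizer G H"
  proof
    fix g assume g: "g \<in> E"
    then have gG: "g \<in> carrier G" by (rule subgroup.mem_carrier[OF E])
    have "g <# H #> inv g = H"
    proof
      show "g <# H #> inv g \<subseteq> H" unfolding conj_set using conj g by blast
      \<comment> \<open>The stabilizer condition is an equality of sets; the second inclusion comes
        from conjugating by \<open>inv g\<close>, which also lies in \<open>E\<close>.\<close>
      show "H \<subseteq> g <# H #> inv g"
      proof
        fix h assume h: "h \<in> H"
        then have hG: "h \<in> carrier G" using HG by blast
        have "inv g \<otimes> h \<otimes> inv (inv g) \<in> H"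
          using conj h subgroup.m_inv_closed[OF E g] by blast
        moreover have "h = g \<otimes> (inv g \<otimes> h \<otimes> inv (inv g)) \<otimes> inv g"
          using gG hG by (simp add: m_assoc inv_cancel)
        ultimately show "h \<in> g <# H #> inv g" unfolding conj_set by blast
      qed
    qed
    then show "g \<in> normalizer G H" using gG HG by (simp add: normalizer_def stabilizer_def)
  qed
qed

end

subsection \<open>Vectors, forms and the orthogonal group\<close>

lemma finite_Omega [simp]: "finite (Omega n)"
  by (simp add: Omega_def)

lemma uminus_Omega [simp]: "- i \<in> Omega n \<longleftrightarrow> i \<in> Omega n"
  by (auto simp: Omega_def)

lemma Omega_nonzero: "i \<in> Omega n \<Longrightarrow> i \<noteq> 0"
  by (auto simp: Omega_def)

lemma Omega_neq_uminus [simp]: "i \<in> Omega n \<Longrightarrow> i \<noteq> - i" "i \<in> Omega n \<Longrightarrow> - i \<noteq> i"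
  by (auto dest: Omega_nonzero)

locale orthogonal = cring R for R (structure) + fixes n :: nat
begin

abbreviation G where "G \<equiv> orth_group R n"
definition vecs where "vecs = Omega n \<rightarrow>\<^sub>E carrier R"
definition mats where "mats = (Omega n \<times> Omega n) \<rightarrow>\<^sub>E carrier R"

definition vadd (infixl "\<oplus>\<^sub>v" 65) where "u \<oplus>\<^sub>v v = (\<lambda>i\<in>Omega n. u i \<oplus> v i)"
definition smul (infixr "\<odot>\<^sub>v" 72) where "c \<odot>\<^sub>v u = (\<lambda>i\<in>Omega n. c \<otimes> u i)"
definition ax where "ax i a = (\<lambda>k\<in>Omega n. if k = i then a else \<zero>)"
text \<open>The polar form of \<open>qf\<close>, as \<open>qf_vadd\<close> confirms; e_k and e_{-k}
  form a hyperbolic pair.\<close>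

definition bil where "bil u v = (\<Oplus>k\<in>Omega n. u k \<otimes> v (- k))"
abbreviation act (infixr "\<bullet>" 74) where "A \<bullet> v \<equiv> mat_vec R (Omega n) A v"
abbreviation qf where "qf \<equiv> quad_form R n"

lemma vec_closed [simp]: "v \<in> vecs \<Longrightarrow> i \<in> Omega n \<Longrightarrow> v i \<in> carrier R"
  unfolding vecs_def by (rule PiE_mem)

lemma mat_closed [simp]: "A \<in> mats \<Longrightarrow> i \<in> Omega n \<Longrightarrow> j \<in> Omega n \<Longrightarrow> A (i, j) \<in> carrier R"
  unfolding mats_def by (erule PiE_mem) simp

lemma vec_eqI: "u \<in> vecs \<Longrightarrow> v \<in> vecs \<Longrightarrow> (\<And>i. i \<in> Omega n \<Longrightarrow> u i = v i) \<Longrightarrow> u = v"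
  unfolding vecs_def by (rule PiE_ext)

lemma mat_eqI:
  "A \<in> mats \<Longrightarrow> B \<in> mats \<Longrightarrow> (\<And>i j. i \<in> Omega n \<Longrightarrow> j \<in> Omega n \<Longrightarrow> A (i, j) = B (i, j)) \<Longrightarrow> A = B"
  unfolding mats_def by (rule PiE_ext) auto

lemma vadd_closed [simp]: "u \<in> vecs \<Longrightarrow> v \<in> vecs \<Longrightarrow> u \<oplus>\<^sub>v v \<in> vecs"
  by (auto simp: vecs_def vadd_def)

lemma smul_closed [simp]: "c \<in> carrier R \<Longrightarrow> v \<in> vecs \<Longrightarrow> c \<odot>\<^sub>v v \<in> vecs"
  by (auto simp: vecs_def smul_def)

lemma ax_closed [simp]: "a \<in> carrier R \<Longrightarrow> ax i a \<in> vecs"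
  by (auto simp: vecs_def ax_def)

lemma vadd_apply [simp]: "i \<in> Omega n \<Longrightarrow> (u \<oplus>\<^sub>v v) i = u i \<oplus> v i"
  by (simp add: vadd_def)

lemma smul_apply [simp]: "i \<in> Omega n \<Longrightarrow> (c \<odot>\<^sub>v v) i = c \<otimes> v i"
  by (simp add: smul_def)

lemma ax_apply [simp]: "k \<in> Omega n \<Longrightarrow> ax i a k = (if k = i then a else \<zero>)"
  by (simp add: ax_def)

lemma smul_ax [simp]: "c \<in> carrier R \<Longrightarrow> a \<in> carrier R \<Longrightarrow> c \<odot>\<^sub>v ax i a = ax i (c \<otimes> a)"
  by (rule vec_eqI) auto

lemma smul_vadd: "c \<in> carrier R \<Longrightarrow> u \<in> vecs \<Longrightarrow> v \<in> vecs \<Longrightarrow> c \<odot>\<^sub>v (u \<oplus>\<^sub>v v) = c \<odot>\<^sub>v u \<oplus>\<^sub>v c \<odot>\<^sub>v v"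
  by (rule vec_eqI) (auto simp: r_distr)

lemma smul_smul [simp]:
  "c \<in> carrier R \<Longrightarrow> d \<in> carrier R \<Longrightarrow> u \<in> vecs \<Longrightarrow> c \<odot>\<^sub>v d \<odot>\<^sub>v u = (c \<otimes> d) \<odot>\<^sub>v u"
  by (rule vec_eqI) (auto simp: m_assoc)

lemma bil_closed [simp]: "u \<in> vecs \<Longrightarrow> v \<in> vecs \<Longrightarrow> bil u v \<in> carrier R"
  unfolding bil_def by (intro finsum_closed) auto

lemma bil_sym: "u \<in> vecs \<Longrightarrow> v \<in> vecs \<Longrightarrow> bil u v = bil v u"
proof -
  assume uv: "u \<in> vecs" "v \<in> vecs"
  have im: "uminus ` Omega n = Omega n"
    by (auto simp: image_iff) (metis add.inverse_inverse uminus_Omega)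
  have "bil u v = (\<Oplus>k\<in>uminus ` Omega n. u k \<otimes> v (- k))" by (simp add: bil_def im)
  also have "\<dots> = (\<Oplus>k\<in>Omega n. u (- k) \<otimes> v (- (- k)))"
    using uv by (intro add.finprod_reindex) (auto simp: inj_on_def)
  also have "\<dots> = bil v u"
    unfolding bil_def using uv by (intro finsum_cong') (auto simp: m_comm)
  finally show ?thesis .
qed

lemma bil_vadd_left [simp]:
  "u \<in> vecs \<Longrightarrow> v \<in> vecs \<Longrightarrow> w \<in> vecs \<Longrightarrow> bil (u \<oplus>\<^sub>v v) w = bil u w \<oplus> bil v w"
proof -
  assume uv: "u \<in> vecs" "v \<in> vecs" "w \<in> vecs"
  have "bil (u \<oplus>\<^sub>v v) w = (\<Oplus>k\<in>Omega n. u k \<otimes> w (- k) \<oplus> v k \<otimes> w (- k))"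
    unfolding bil_def using uv by (intro finsum_cong') (auto simp: l_distr)
  also have "\<dots> = bil u w \<oplus> bil v w"
    unfolding bil_def using uv by (intro finsum_addf) auto
  finally show ?thesis .
qed

lemma bil_vadd_right [simp]:
  "u \<in> vecs \<Longrightarrow> v \<in> vecs \<Longrightarrow> w \<in> vecs \<Longrightarrow> bil w (u \<oplus>\<^sub>v v) = bil w u \<oplus> bil w v"
  by (simp add: bil_sym[of w])

lemma bil_smul_left [simp]:
  "c \<in> carrier R \<Longrightarrow> u \<in> vecs \<Longrightarrow> w \<in> vecs \<Longrightarrow> bil (c \<odot>\<^sub>v u) w = c \<otimes> bil u w"
proof -
  assume uv: "c \<in> carrier R" "u \<in> vecs" "w \<in> vecs"
  have "c \<otimes> bil u w = (\<Oplus>k\<in>Omega n. c \<otimes> (u k \<otimes> w (- k)))"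
    unfolding bil_def using uv by (intro finsum_rdistr) auto
  also have "\<dots> = bil (c \<odot>\<^sub>v u) w"
    unfolding bil_def using uv by (intro finsum_cong') (auto simp: m_assoc)
  finally show ?thesis by simp
qed

lemma bil_smul_right [simp]:
  "c \<in> carrier R \<Longrightarrow> u \<in> vecs \<Longrightarrow> w \<in> vecs \<Longrightarrow> bil w (c \<odot>\<^sub>v u) = c \<otimes> bil w u"
  by (simp add: bil_sym[of w])

lemma bil_ax_left [simp]:
  "a \<in> carrier R \<Longrightarrow> i \<in> Omega n \<Longrightarrow> w \<in> vecs \<Longrightarrow> bil (ax i a) w = a \<otimes> w (- i)"
proof -
  assume *: "a \<in> carrier R" "i \<in> Omega n" "w \<in> vecs"
  have "bil (ax i a) w = (\<Oplus>k\<in>Omega n. if k = i then a \<otimes> w (- k) else \<zero>)"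
    unfolding bil_def using * by (intro finsum_cong') auto
  also have "\<dots> = a \<otimes> w (- i)" using * by (intro finsum_delta) auto
  finally show ?thesis .
qed

lemma bil_ax_right [simp]:
  "a \<in> carrier R \<Longrightarrow> i \<in> Omega n \<Longrightarrow> w \<in> vecs \<Longrightarrow> bil w (ax i a) = a \<otimes> w (- i)"
  by (simp add: bil_sym[of w])

lemma act_apply: "i \<in> Omega n \<Longrightarrow> (A \<bullet> v) i = (\<Oplus>k\<in>Omega n. A (i, k) \<otimes> v k)"
  by (simp add: mat_vec_def)

text \<open>For positive \<open>i\<close> and negative \<open>k\<close> the skew diagonal condition
  on positions reads i + (n + 1 + k) = n + 1, that is, k = -i.\<close>

lemma form_mat_apply:
  assumes "i \<in> Omega n" "k \<in> Omega n"
  shows "form_mat R n (i, k) = (if 0 < i \<and> k = - i then \<one> else \<zero>)"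
proof -
  have "i \<noteq> 0" "k \<noteq> 0" "i \<le> int n" "k \<le> int n" "- int n \<le> i" "- int n \<le> k"
    using assms by (auto simp: Omega_def)
  then show ?thesis using assms
    by (cases "0 < i"; cases "0 < k") (auto simp: form_mat_def skew_id_def pos_def)
qed

lemma qf_eq: "v \<in> vecs \<Longrightarrow> qf v = (\<Oplus>k\<in>{1..int n}. v k \<otimes> v (- k))"
proof -
  assume v: "v \<in> vecs"
  have *: "mat_vec R (Omega n) (form_mat R n) v i = (if 0 < i then v (- i) else \<zero>)" if i: "i \<in> Omega n" for i
  proof -
    have "mat_vec R (Omega n) (form_mat R n) v i
        = (\<Oplus>k\<in>Omega n. if k = - i then (if 0 < i then v k else \<zero>) else \<zero>)"
      unfolding act_apply[OF i]
    proof (rule finsum_cong')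
      fix k assume k: "k \<in> Omega n"
      show "form_mat R n (i, k) \<otimes> v k = (if k = - i then if 0 < i then v k else \<zero> else \<zero>)"
        using v k form_mat_apply[OF i k] by (cases "k = - i"; cases "0 < i") simp_all
    qed (use v in auto)
    also have "\<dots> = (if 0 < i then v (- i) else \<zero>)" using i v by (intro finsum_delta) auto
    finally show ?thesis .
  qed
  have "qf v = (\<Oplus>i\<in>Omega n. v i \<otimes> (if 0 < i then v (- i) else \<zero>))"
    unfolding quad_form_def using v by (intro finsum_cong') (auto simp: *)
  also have "\<dots> = (\<Oplus>k\<in>{1..int n}. v k \<otimes> v (- k))"
  proof (rule add.finprod_mono_neutral_cong_right)
    show "{1..int n} \<subseteq> Omega n" by (auto simp: Omega_def)
    show "v i \<otimes> (if 0 < i then v (- i) else \<zero>) = \<zero>" if "i \<in> Omega n - {1..int n}" for i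
      using v that by (auto simp: Omega_def intro!: r_null vec_closed)
    show "(\<lambda>i. v i \<otimes> (if 0 < i then v (- i) else \<zero>)) \<in> Omega n \<rightarrow> carrier R"
      using v by auto
  qed simp_all
  finally show ?thesis .
qed

lemma pos_in_Omega [simp]: "k \<in> {1..int n} \<Longrightarrow> k \<in> Omega n"
  by (simp add: Omega_def)

lemma qf_closed [simp]: "v \<in> vecs \<Longrightarrow> qf v \<in> carrier R"
  unfolding qf_eq by (intro finsum_closed) (auto simp del: atLeastAtMost_iff)

lemma bil_pos: "u \<in> vecs \<Longrightarrow> v \<in> vecs \<Longrightarrow>
  bil u v = (\<Oplus>k\<in>{1..int n}. u k \<otimes> v (- k) \<oplus> u (- k) \<otimes> v k)"
proof -
  assume uv: "u \<in> vecs" "v \<in> vecs"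
  have O: "Omega n = {1..int n} \<union> uminus ` {1..int n}"
    unfolding Omega_def image_uminus_atLeastAtMost by simp
  have cl: "(\<lambda>k. u k \<otimes> v (- k)) \<in> {1..int n} \<rightarrow> carrier R"
    "(\<lambda>k. u k \<otimes> v (- k)) \<in> uminus ` {1..int n} \<rightarrow> carrier R"
    using uv by (intro funcsetI m_closed vec_closed; simp add: Omega_def)+
  have "bil u v = (\<Oplus>k\<in>{1..int n}. u k \<otimes> v (- k)) \<oplus> (\<Oplus>k\<in>uminus ` {1..int n}. u k \<otimes> v (- k))"
    unfolding bil_def O by (rule add.finprod_Un_disjoint[OF _ _ _ cl]) auto
  also have "(\<Oplus>k\<in>uminus ` {1..int n}. u k \<otimes> v (- k)) = (\<Oplus>k\<in>{1..int n}. u (- k) \<otimes> v (- (- k)))"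
    using cl by (intro add.finprod_reindex) (auto simp: inj_on_def)
  also have "(\<Oplus>k\<in>{1..int n}. u k \<otimes> v (- k)) \<oplus> \<dots> = (\<Oplus>k\<in>{1..int n}. u k \<otimes> v (- k) \<oplus> u (- k) \<otimes> v k)"
    using uv by (subst finsum_addf) (simp_all add: Pi_def)
  finally show ?thesis .
qed

lemma qf_vadd_aux:
  assumes "a \<in> carrier R" "b \<in> carrier R" "c \<in> carrier R" "d \<in> carrier R"
  shows "(a \<oplus> b) \<otimes> (c \<oplus> d) = a \<otimes> c \<oplus> b \<otimes> d \<oplus> (a \<otimes> d \<oplus> c \<otimes> b)"
  using assms by algebra

lemma qf_vadd [simp]: "u \<in> vecs \<Longrightarrow> v \<in> vecs \<Longrightarrow> qf (u \<oplus>\<^sub>v v) = qf u \<oplus> qf v \<oplus> bil u v"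
proof -
  assume uv: "u \<in> vecs" "v \<in> vecs"
  have "qf (u \<oplus>\<^sub>v v) = (\<Oplus>k\<in>{1..int n}. u k \<otimes> u (- k) \<oplus> v k \<otimes> v (- k) \<oplus> (u k \<otimes> v (- k) \<oplus> u (- k) \<otimes> v k))"
    unfolding qf_eq[OF vadd_closed[OF uv]] using uv by (intro finsum_cong') (simp_all add: Pi_def qf_vadd_aux)
  also have "\<dots> = qf u \<oplus> qf v \<oplus> bil u v"
    using uv by (simp add: qf_eq bil_pos pos_in_Omega finsum_addf Pi_def)
  finally show ?thesis .
qed

lemma qf_smul [simp]: "c \<in> carrier R \<Longrightarrow> u \<in> vecs \<Longrightarrow> qf (c \<odot>\<^sub>v u) = c \<otimes> c \<otimes> qf u"
proof -
  assume uv: "c \<in> carrier R" "u \<in> vecs"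
  have "c \<otimes> c \<otimes> qf u = (\<Oplus>k\<in>{1..int n}. c \<otimes> c \<otimes> (u k \<otimes> u (- k)))"
    using uv by (simp add: qf_eq, intro finsum_rdistr) (auto simp del: atLeastAtMost_iff)
  also have "\<dots> = qf (c \<odot>\<^sub>v u)"
    unfolding qf_eq[OF smul_closed[OF uv]] using uv by (intro finsum_cong') (simp_all add: Pi_def m_ac)
  finally show ?thesis by simp
qed

lemma qf_ax [simp]: "a \<in> carrier R \<Longrightarrow> qf (ax i a) = \<zero>"
  by (auto simp: qf_eq pos_in_Omega intro!: finsum_all_zero)

section \<open>Matrices as operators on columns, and the group of isometries\<close>

lemma act_closed [simp]: "A \<in> mats \<Longrightarrow> v \<in> vecs \<Longrightarrow> A \<bullet> v \<in> vecs"
  unfolding mat_vec_def vecs_def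
  by (rule restrict_PiE_iff[THEN iffD2]) (auto simp flip: vecs_def intro!: finsum_closed)

lemma act_ax: "A \<in> mats \<Longrightarrow> i \<in> Omega n \<Longrightarrow> j \<in> Omega n \<Longrightarrow> a \<in> carrier R \<Longrightarrow> (A \<bullet> ax j a) i = A (i, j) \<otimes> a"
proof -
  assume *: "A \<in> mats" "i \<in> Omega n" "j \<in> Omega n" "a \<in> carrier R"
  have "(A \<bullet> ax j a) i = (\<Oplus>k\<in>Omega n. if k = j then A (i, k) \<otimes> a else \<zero>)"
    unfolding act_apply[OF *(2)] using * by (intro finsum_cong') auto
  also have "\<dots> = A (i, j) \<otimes> a" using * by (intro finsum_delta) auto
  finally show ?thesis .
qed

lemma act_vadd [simp]:
  "A \<in> mats \<Longrightarrow> u \<in> vecs \<Longrightarrow> v \<in> vecs \<Longrightarrow> A \<bullet> (u \<oplus>\<^sub>v v) = A \<bullet> u \<oplus>\<^sub>v A \<bullet> v"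
proof (rule vec_eqI)
  assume *: "A \<in> mats" "u \<in> vecs" "v \<in> vecs"
  fix i assume i: "i \<in> Omega n"
  have "(A \<bullet> (u \<oplus>\<^sub>v v)) i = (\<Oplus>k\<in>Omega n. A (i, k) \<otimes> u k \<oplus> A (i, k) \<otimes> v k)"
    unfolding act_apply[OF i] using * i by (intro finsum_cong') (auto simp: r_distr)
  also have "\<dots> = (A \<bullet> u \<oplus>\<^sub>v A \<bullet> v) i" using * i by (simp add: act_apply finsum_addf Pi_def)
  finally show "(A \<bullet> (u \<oplus>\<^sub>v v)) i = (A \<bullet> u \<oplus>\<^sub>v A \<bullet> v) i" .
qed simp_all

lemma act_smul [simp]:
  "A \<in> mats \<Longrightarrow> c \<in> carrier R \<Longrightarrow> v \<in> vecs \<Longrightarrow> A \<bullet> (c \<odot>\<^sub>v v) = c \<odot>\<^sub>v A \<bullet> v"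
proof (rule vec_eqI)
  assume *: "A \<in> mats" "c \<in> carrier R" "v \<in> vecs"
  fix i assume i: "i \<in> Omega n"
  have "(c \<odot>\<^sub>v A \<bullet> v) i = (\<Oplus>k\<in>Omega n. c \<otimes> (A (i, k) \<otimes> v k))"
    using i * by (simp add: act_apply finsum_rdistr Pi_def)
  also have "\<dots> = (A \<bullet> (c \<odot>\<^sub>v v)) i"
    unfolding act_apply[OF i] using * i by (intro finsum_cong') (auto simp: m_ac)
  finally show "(A \<bullet> (c \<odot>\<^sub>v v)) i = (c \<odot>\<^sub>v A \<bullet> v) i" by simp
qed simp_all

lemma sum_assoc:
  assumes "f \<in> Omega n \<rightarrow> carrier R" "h \<in> Omega n \<rightarrow> carrier R" "B \<in> mats"
  shows "(\<Oplus>k\<in>Omega n. (\<Oplus>l\<in>Omega n. f l \<otimes> B (l, k)) \<otimes> h k) = (\<Oplus>l\<in>Omega n. f l \<otimes> (\<Oplus>k\<in>Omega n. B (l, k) \<otimes> h k))"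
proof -
  have "(\<Oplus>k\<in>Omega n. (\<Oplus>l\<in>Omega n. f l \<otimes> B (l, k)) \<otimes> h k) = (\<Oplus>k\<in>Omega n. \<Oplus>l\<in>Omega n. f l \<otimes> (B (l, k) \<otimes> h k))"
    using assms by (intro finsum_cong') (auto simp: finsum_ldistr Pi_def m_assoc intro!: finsum_cong')
  also have "\<dots> = (\<Oplus>l\<in>Omega n. \<Oplus>k\<in>Omega n. f l \<otimes> (B (l, k) \<otimes> h k))"
    using assms by (intro finsum_swap) (auto simp: Pi_def)
  also have "\<dots> = (\<Oplus>l\<in>Omega n. f l \<otimes> (\<Oplus>k\<in>Omega n. B (l, k) \<otimes> h k))"
    using assms by (intro finsum_cong') (auto simp: finsum_rdistr Pi_def)
  finally show ?thesis .
qed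

abbreviation mat_mult (infixl "\<otimes>\<^sub>m" 70) where "A \<otimes>\<^sub>m B \<equiv> A \<otimes>\<^bsub>mat_ring R (Omega n)\<^esub> B"

lemma mat_carrier [simp]: "carrier (mat_ring R (Omega n)) = mats"
  by (simp add: mat_ring_def mats_def)

lemma mat_mult_apply: "i \<in> Omega n \<Longrightarrow> j \<in> Omega n \<Longrightarrow> (A \<otimes>\<^sub>m B) (i, j) = (\<Oplus>k\<in>Omega n. A (i, k) \<otimes> B (k, j))"
  by (simp add: mat_ring_def)

lemma mat_one_apply: "i \<in> Omega n \<Longrightarrow> j \<in> Omega n \<Longrightarrow> \<one>\<^bsub>mat_ring R (Omega n)\<^esub> (i, j) = (if i = j then \<one> else \<zero>)"
  by (simp add: mat_ring_def)

lemma mat_one_closed [simp]: "\<one>\<^bsub>mat_ring R (Omega n)\<^esub> \<in> mats"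
  by (auto simp: mats_def mat_ring_def)

lemma mat_mult_closed [simp]: "A \<in> mats \<Longrightarrow> B \<in> mats \<Longrightarrow> A \<otimes>\<^sub>m B \<in> mats"
proof -
  assume AB: "A \<in> mats" "B \<in> mats"
  then have "(\<Oplus>k\<in>Omega n. A (i, k) \<otimes> B (k, j)) \<in> carrier R" if "i \<in> Omega n" "j \<in> Omega n" for i j
    using that by (auto intro!: finsum_closed)
  then show ?thesis unfolding mats_def by (auto simp: mat_ring_def)
qed

lemma act_mult: "A \<in> mats \<Longrightarrow> B \<in> mats \<Longrightarrow> v \<in> vecs \<Longrightarrow> (A \<otimes>\<^sub>m B) \<bullet> v = A \<bullet> B \<bullet> v"
proof (rule vec_eqI)
  assume *: "A \<in> mats" "B \<in> mats" "v \<in> vecs"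
  fix i assume i: "i \<in> Omega n"
  have "((A \<otimes>\<^sub>m B) \<bullet> v) i = (\<Oplus>k\<in>Omega n. (\<Oplus>l\<in>Omega n. A (i, l) \<otimes> B (l, k)) \<otimes> v k)"
    unfolding act_apply[OF i] using * i by (intro finsum_cong') (auto simp: mat_mult_apply)
  also have "\<dots> = (\<Oplus>l\<in>Omega n. A (i, l) \<otimes> (\<Oplus>k\<in>Omega n. B (l, k) \<otimes> v k))"
    using * i by (intro sum_assoc) auto
  also have "\<dots> = (A \<bullet> B \<bullet> v) i"
    unfolding act_apply[OF i] using * i by (intro finsum_cong') (auto simp: act_apply)
  finally show "((A \<otimes>\<^sub>m B) \<bullet> v) i = (A \<bullet> B \<bullet> v) i" .
qed simp_all

text \<open>The images of the columns \<open>ax j \<one>\<close> recover all entries. Hence matrix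
  identities, beginning with associativity, can be proved as identities of operators.\<close>

lemma mat_eq_actI:
  assumes "A \<in> mats" "B \<in> mats" "\<And>v. v \<in> vecs \<Longrightarrow> A \<bullet> v = B \<bullet> v"
  shows "A = B"
proof (rule mat_eqI)
  fix i j assume ij: "i \<in> Omega n" "j \<in> Omega n"
  have "(A \<bullet> ax j \<one>) i = (B \<bullet> ax j \<one>) i" using assms(3) by simp
  then show "A (i, j) = B (i, j)" using assms(1,2) ij by (simp add: act_ax)
qed (fact assms)+

lemma act_one: "v \<in> vecs \<Longrightarrow> \<one>\<^bsub>mat_ring R (Omega n)\<^esub> \<bullet> v = v"
proof (rule vec_eqI)
  assume *: "v \<in> vecs"
  fix i assume i: "i \<in> Omega n"
  have "(\<one>\<^bsub>mat_ring R (Omega n)\<^esub> \<bullet> v) i = (\<Oplus>k\<in>Omega n. if k = i then v k else \<zero>)"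
    unfolding act_apply[OF i] using * i by (intro finsum_cong') (auto simp: mat_one_apply)
  also have "\<dots> = v i" using * i by (intro finsum_delta) auto
  finally show "(\<one>\<^bsub>mat_ring R (Omega n)\<^esub> \<bullet> v) i = v i" .
qed simp_all

sublocale M: monoid "mat_ring R (Omega n)"
proof
  fix x y z assume "x \<in> carrier (mat_ring R (Omega n))" "y \<in> carrier (mat_ring R (Omega n))"
    "z \<in> carrier (mat_ring R (Omega n))"
  then show "x \<otimes>\<^sub>m y \<otimes>\<^sub>m z = x \<otimes>\<^sub>m (y \<otimes>\<^sub>m z)"
    by (intro mat_eq_actI) (simp_all add: act_mult)
next
  fix x assume "x \<in> carrier (mat_ring R (Omega n))"
  then show "\<one>\<^bsub>mat_ring R (Omega n)\<^esub> \<otimes>\<^sub>m x = x" "x \<otimes>\<^sub>m \<one>\<^bsub>mat_ring R (Omega n)\<^esub> = x"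
    by (intro mat_eq_actI; simp add: act_mult act_one)+
qed simp_all

lemma G_mult [simp]: "x \<otimes>\<^bsub>G\<^esub> y = x \<otimes>\<^sub>m y"
  by (simp add: orth_group_def GL_def units_of_def)

lemma G_one: "\<one>\<^bsub>G\<^esub> = \<one>\<^bsub>mat_ring R (Omega n)\<^esub>"
  by (simp add: orth_group_def GL_def units_of_def)

lemma G_carrier: "A \<in> carrier G \<longleftrightarrow> A \<in> Units (mat_ring R (Omega n)) \<and> (\<forall>v\<in>vecs. qf (A \<bullet> v) = qf v)"
  by (simp add: orth_group_def GL_def units_of_def vecs_def)

lemma G_mats [simp]: "A \<in> carrier G \<Longrightarrow> A \<in> mats"
  using G_carrier M.Units_closed by auto

sublocale G: group G
proof (rule groupI)
  fix x assume x: "x \<in> carrier G"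
  then have u: "x \<in> Units (mat_ring R (Omega n))" by (simp add: G_carrier)
  let ?y = "inv\<^bsub>mat_ring R (Omega n)\<^esub> x"
  have y: "?y \<in> mats" using M.Units_inv_closed[OF u] by simp
  have "qf (?y \<bullet> v) = qf v" if v: "v \<in> vecs" for v
  proof -
    have "qf (?y \<bullet> v) = qf (x \<bullet> ?y \<bullet> v)" using x y v by (simp add: G_carrier)
    also have "x \<bullet> ?y \<bullet> v = v"
      using act_mult[of x ?y v] x y v M.Units_r_inv[OF u] by (simp add: act_one)
    finally show ?thesis .
  qed
  then show "\<exists>y\<in>carrier G. y \<otimes>\<^bsub>G\<^esub> x = \<one>\<^bsub>G\<^esub>"
    using u by (intro bexI[of _ ?y]) (auto simp: G_carrier G_one)
qed (auto simp: G_carrier G_one act_one act_mult M.m_assoc dest: M.Units_closed)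

declare G_mult [simp del]

lemma act_G_mult [simp]: "A \<in> carrier G \<Longrightarrow> B \<in> carrier G \<Longrightarrow> v \<in> vecs \<Longrightarrow> (A \<otimes>\<^bsub>G\<^esub> B) \<bullet> v = A \<bullet> B \<bullet> v"
  by (simp add: G_mult act_mult)

lemma act_G_one [simp]: "v \<in> vecs \<Longrightarrow> \<one>\<^bsub>G\<^esub> \<bullet> v = v"
  by (simp add: G_one act_one)

lemma act_inv_left [simp]: "A \<in> carrier G \<Longrightarrow> v \<in> vecs \<Longrightarrow> inv\<^bsub>G\<^esub> A \<bullet> A \<bullet> v = v"
  using act_G_mult[of "inv\<^bsub>G\<^esub> A" A v] by (simp del: act_G_mult)

lemma act_inv_right [simp]: "A \<in> carrier G \<Longrightarrow> v \<in> vecs \<Longrightarrow> A \<bullet> inv\<^bsub>G\<^esub> A \<bullet> v = v"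
  using act_G_mult[of A "inv\<^bsub>G\<^esub> A" v] by (simp del: act_G_mult)

lemma qf_act [simp]: "A \<in> carrier G \<Longrightarrow> v \<in> vecs \<Longrightarrow> qf (A \<bullet> v) = qf v"
  by (simp add: G_carrier)

text \<open>Polarization: the quadratic form is preserved on u, v and u + v, hence so is the cross
  term.\<close>

lemma bil_act [simp]:
  assumes "A \<in> carrier G" "u \<in> vecs" "v \<in> vecs"
  shows "bil (A \<bullet> u) (A \<bullet> v) = bil u v"
proof -
  have "qf u \<oplus> qf v \<oplus> bil (A \<bullet> u) (A \<bullet> v) = qf (A \<bullet> (u \<oplus>\<^sub>v v))" using assms by simp
  also have "\<dots> = qf u \<oplus> qf v \<oplus> bil u v" using assms by (simp del: act_vadd)
  finally show ?thesis using assms by simp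
qed

lemma G_eqI:
  "A \<in> carrier G \<Longrightarrow> B \<in> carrier G \<Longrightarrow> (\<And>v. v \<in> vecs \<Longrightarrow> A \<bullet> v = B \<bullet> v) \<Longrightarrow> A = B"
  using mat_eq_actI[OF G_mats G_mats] by blast

lemma G_memI:
  assumes "A \<in> mats" "B \<in> mats" "\<And>v. v \<in> vecs \<Longrightarrow> A \<bullet> B \<bullet> v = v" "\<And>v. v \<in> vecs \<Longrightarrow> B \<bullet> A \<bullet> v = v"
    "\<And>v. v \<in> vecs \<Longrightarrow> qf (A \<bullet> v) = qf v"
  shows "A \<in> carrier G"
proof -
  have "A \<otimes>\<^sub>m B = \<one>\<^bsub>mat_ring R (Omega n)\<^esub>"
    by (rule mat_eq_actI) (simp_all add: assms act_mult act_one)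
  moreover have "B \<otimes>\<^sub>m A = \<one>\<^bsub>mat_ring R (Omega n)\<^esub>"
    by (rule mat_eq_actI) (simp_all add: assms act_mult act_one)
  ultimately have "A \<in> Units (mat_ring R (Omega n))"
    unfolding Units_def using assms(1,2) by auto
  then show ?thesis unfolding G_carrier using assms(5) by blast
qed

subsection \<open>Eichler transformations\<close>

text \<open>The Eichler transformation \<open>w \<mapsto> w + \<langle>v, w\<rangle>u - \<langle>u, w\<rangle>v - q(v)\<langle>u, w\<rangle>u\<close>; it is orthogonal only if
  \<open>u\<close> is isotropic and orthogonal to \<open>v\<close>.\<close>

definition eich where
  "eich u v = (\<lambda>(a, b)\<in>Omega n \<times> Omega n.
     (if a = b then \<one> else \<zero>) \<oplus> u a \<otimes> v (- b) \<ominus> v a \<otimes> u (- b) \<ominus> qf v \<otimes> u a \<otimes> u (- b))"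

lemma eich_apply: "a \<in> Omega n \<Longrightarrow> b \<in> Omega n \<Longrightarrow> eich u v (a, b) =
    (if a = b then \<one> else \<zero>) \<oplus> u a \<otimes> v (- b) \<ominus> v a \<otimes> u (- b) \<ominus> qf v \<otimes> u a \<otimes> u (- b)"
  by (simp add: eich_def)

lemma eich_mats [simp]: "u \<in> vecs \<Longrightarrow> v \<in> vecs \<Longrightarrow> eich u v \<in> mats"
proof -
  assume *: "u \<in> vecs" "v \<in> vecs"
  then have "(if a = b then \<one> else \<zero>) \<oplus> u a \<otimes> v (- b) \<ominus> v a \<otimes> u (- b) \<ominus> qf v \<otimes> u a \<otimes> u (- b) \<in> carrier R"
    if "a \<in> Omega n" "b \<in> Omega n" for a b using that by simp
  then show ?thesis unfolding mats_def eich_def by auto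
qed

text \<open>Splits one term of the coordinate sum in \<open>act_eich\<close> into a diagonal part
  and fixed multiples of the summands of <v, w> and <u, w>.\<close>

lemma eich_ring:
  assumes "d \<in> carrier R" "a \<in> carrier R" "b \<in> carrier R" "c \<in> carrier R" "e \<in> carrier R" "f \<in> carrier R" "w \<in> carrier R"
  shows "(d \<oplus> a \<otimes> b \<ominus> c \<otimes> e \<ominus> f \<otimes> a \<otimes> e) \<otimes> w = d \<otimes> w \<oplus> (a \<otimes> (w \<otimes> b) \<oplus> (\<ominus> c \<ominus> f \<otimes> a) \<otimes> (w \<otimes> e))"
  using assms by algebra

lemma eich_ring2:
  assumes "w \<in> carrier R" "a \<in> carrier R" "b \<in> carrier R" "c \<in> carrier R" "e \<in> carrier R" "f \<in> carrier R"
  shows "w \<oplus> (a \<otimes> b \<oplus> (\<ominus> c \<ominus> f \<otimes> a) \<otimes> e) = w \<oplus> (b \<ominus> f \<otimes> e) \<otimes> a \<oplus> \<ominus> e \<otimes> c"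
  using assms by algebra

lemma act_eich:
  assumes uvw: "u \<in> vecs" "v \<in> vecs" "w \<in> vecs"
  shows "eich u v \<bullet> w = w \<oplus>\<^sub>v (bil v w \<ominus> qf v \<otimes> bil u w) \<odot>\<^sub>v u \<oplus>\<^sub>v (\<ominus> bil u w) \<odot>\<^sub>v v"
proof (rule vec_eqI)
  fix i assume i: "i \<in> Omega n"
  let ?c = "\<ominus> v i \<ominus> qf v \<otimes> u i"
  have "(eich u v \<bullet> w) i = (\<Oplus>k\<in>Omega n. (if k = i then w k else \<zero>) \<oplus>
      (u i \<otimes> (w k \<otimes> v (- k)) \<oplus> ?c \<otimes> (w k \<otimes> u (- k))))"
    unfolding act_apply[OF i]
  proof (rule finsum_cong')
    fix k assume k: "k \<in> Omega n"
    show "eich u v (i, k) \<otimes> w k = (if k = i then w k else \<zero>) \<oplus>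
      (u i \<otimes> (w k \<otimes> v (- k)) \<oplus> ?c \<otimes> (w k \<otimes> u (- k)))"
      unfolding eich_apply[OF i k] using uvw i k by (subst eich_ring) auto
  qed (use uvw i in auto)
  also have "\<dots> = (\<Oplus>k\<in>Omega n. if k = i then w k else \<zero>) \<oplus>
     ((\<Oplus>k\<in>Omega n. u i \<otimes> (w k \<otimes> v (- k))) \<oplus> (\<Oplus>k\<in>Omega n. ?c \<otimes> (w k \<otimes> u (- k))))"
    using uvw i by (simp add: finsum_addf Pi_def)
  also have "(\<Oplus>k\<in>Omega n. if k = i then w k else \<zero>) = w i"
    using uvw i by (intro finsum_delta) auto
  also have "(\<Oplus>k\<in>Omega n. u i \<otimes> (w k \<otimes> v (- k))) = u i \<otimes> bil v w"
    unfolding bil_sym[OF uvw(2,3)] unfolding bil_def using uvw i by (subst finsum_rdistr) auto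
  also have "(\<Oplus>k\<in>Omega n. ?c \<otimes> (w k \<otimes> u (- k))) = ?c \<otimes> bil u w"
    unfolding bil_sym[OF uvw(1,3)] unfolding bil_def using uvw i by (subst finsum_rdistr) auto
  also have "w i \<oplus> (u i \<otimes> bil v w \<oplus> ?c \<otimes> bil u w) =
    (w \<oplus>\<^sub>v (bil v w \<ominus> qf v \<otimes> bil u w) \<odot>\<^sub>v u \<oplus>\<^sub>v (\<ominus> bil u w) \<odot>\<^sub>v v) i"
    using uvw i by (simp add: eich_ring2)
  finally show "(eich u v \<bullet> w) i = (w \<oplus>\<^sub>v (bil v w \<ominus> qf v \<otimes> bil u w) \<odot>\<^sub>v u \<oplus>\<^sub>v (\<ominus> bil u w) \<odot>\<^sub>v v) i" .
qed (use uvw in simp_all)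

lemma bil_self: "u \<in> vecs \<Longrightarrow> bil u u = qf u \<oplus> qf u"
proof -
  assume u: "u \<in> vecs"
  have "(\<Oplus>k\<in>{1..int n}. u (- k) \<otimes> u k) = qf u"
    unfolding qf_eq[OF u] using u by (intro finsum_cong') (simp_all add: m_comm Pi_def)
  then show ?thesis using u by (simp add: bil_pos qf_eq finsum_addf Pi_def)
qed

lemma bil_zero_sym: "bil u v = \<zero> \<Longrightarrow> u \<in> vecs \<Longrightarrow> v \<in> vecs \<Longrightarrow> bil v u = \<zero>"
  by (simp add: bil_sym)

lemma eich_comp_ring:
  assumes "w \<in> carrier R" "u \<in> carrier R" "v \<in> carrier R" "v' \<in> carrier R" "x \<in> carrier R" "y \<in> carrier R"
    "y' \<in> carrier R" "b \<in> carrier R" "Q \<in> carrier R" "Q' \<in> carrier R"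
  shows "w \<oplus> (y' \<ominus> Q' \<otimes> x) \<otimes> u \<oplus> \<ominus> x \<otimes> v' \<oplus> (y \<oplus> \<ominus> x \<otimes> b \<ominus> Q \<otimes> x) \<otimes> u \<oplus> \<ominus> x \<otimes> v =
    w \<oplus> (y \<oplus> y' \<ominus> (Q \<oplus> Q' \<oplus> b) \<otimes> x) \<otimes> u \<oplus> \<ominus> x \<otimes> (v \<oplus> v')"
  using assms by algebra

text \<open>The inner map preserves the pairing with u and changes the pairing with v by -<u, w><v,
  v'>. This is exactly the cross term by which q(v + v') exceeds q(v) + q(v').\<close>

lemma act_eich_eich:
  assumes uvw: "u \<in> vecs" "v \<in> vecs" "v' \<in> vecs" "w \<in> vecs" "qf u = \<zero>" "bil u v = \<zero>" "bil u v' = \<zero>"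
  shows "eich u v \<bullet> eich u v' \<bullet> w = eich u (v \<oplus>\<^sub>v v') \<bullet> w"
proof -
  have 1: "bil u (eich u v' \<bullet> w) = bil u w" "bil v (eich u v' \<bullet> w) = bil v w \<oplus> \<ominus> bil u w \<otimes> bil v v'"
    using uvw bil_sym[of v u] by (simp_all add: act_eich bil_self)
  show ?thesis
  proof (rule vec_eqI)
    fix i assume i: "i \<in> Omega n"
    show "(eich u v \<bullet> eich u v' \<bullet> w) i = (eich u (v \<oplus>\<^sub>v v') \<bullet> w) i"
      using uvw i by (simp add: act_eich[of u v "eich u v' \<bullet> w"] 1) (simp add: act_eich eich_comp_ring)
  qed (use uvw in simp_all)
qed

lemma eich_zero_vec: "u \<in> vecs \<Longrightarrow> w \<in> vecs \<Longrightarrow> eich u (\<zero> \<odot>\<^sub>v v) \<bullet> w = w" if "v \<in> vecs"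
  using that by (intro vec_eqI) (simp_all add: act_eich minus_eq)

lemma qf_act_ring:
  assumes "w \<in> carrier R" "x \<in> carrier R" "y \<in> carrier R" "Q \<in> carrier R"
  shows "w \<oplus> (y \<ominus> Q \<otimes> x) \<otimes> x \<oplus> (\<ominus> x \<otimes> \<ominus> x \<otimes> Q) \<oplus> (\<ominus> x \<otimes> y) = w"
  using assms by algebra

lemma smul_minus_cancel: "v \<in> vecs \<Longrightarrow> v \<oplus>\<^sub>v (\<ominus> \<one>) \<odot>\<^sub>v v = \<zero> \<odot>\<^sub>v v" "v \<in> vecs \<Longrightarrow> (\<ominus> \<one>) \<odot>\<^sub>v v \<oplus>\<^sub>v v = \<zero> \<odot>\<^sub>v v"
  by (rule vec_eqI; simp add: l_minus r_neg l_neg)+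

lemma eich_closed [simp]:
  assumes uv: "u \<in> vecs" "v \<in> vecs" "qf u = \<zero>" "bil u v = \<zero>"
  shows "eich u v \<in> carrier G"
\<comment> \<open>By additivity in the second argument, the transformation with -v is a two-sided
  inverse.\<close>
proof (rule G_memI[where B = "eich u ((\<ominus> \<one>) \<odot>\<^sub>v v)"])
  fix w assume w: "w \<in> vecs"
  show "eich u v \<bullet> eich u ((\<ominus> \<one>) \<odot>\<^sub>v v) \<bullet> w = w" "eich u ((\<ominus> \<one>) \<odot>\<^sub>v v) \<bullet> eich u v \<bullet> w = w"
    using uv w by (simp_all add: act_eich_eich smul_minus_cancel eich_zero_vec)
  show "qf (eich u v \<bullet> w) = qf w"
    using uv w qf_act_ring[of "qf w" "bil u w" "bil v w" "qf v"] bil_sym[of w u] bil_sym[of w v]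
    by (simp add: act_eich)
qed (use uv in simp_all)

lemma eich_add:
  assumes "u \<in> vecs" "v \<in> vecs" "v' \<in> vecs" "qf u = \<zero>" "bil u v = \<zero>" "bil u v' = \<zero>"
  shows "eich u (v \<oplus>\<^sub>v v') = eich u v \<otimes>\<^bsub>G\<^esub> eich u v'"
  by (rule G_eqI) (use assms in \<open>simp_all add: act_eich_eich\<close>)

lemma eich_inv:
  assumes "u \<in> vecs" "v \<in> vecs" "qf u = \<zero>" "bil u v = \<zero>"
  shows "inv\<^bsub>G\<^esub> (eich u v) = eich u ((\<ominus> \<one>) \<odot>\<^sub>v v)"
proof (rule G.inv_equality)
  show "eich u ((\<ominus> \<one>) \<odot>\<^sub>v v) \<otimes>\<^bsub>G\<^esub> eich u v = \<one>\<^bsub>G\<^esub>"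
    by (rule G_eqI) (use assms in \<open>simp_all add: act_eich_eich smul_minus_cancel eich_zero_vec\<close>)
qed (use assms in simp_all)

lemma bil_inv: "A \<in> carrier G \<Longrightarrow> u \<in> vecs \<Longrightarrow> w \<in> vecs \<Longrightarrow> bil u (inv\<^bsub>G\<^esub> A \<bullet> w) = bil (A \<bullet> u) w"
  using bil_act[of A u "inv\<^bsub>G\<^esub> A \<bullet> w"] by simp

lemma eich_conj:
  assumes "A \<in> carrier G" "u \<in> vecs" "v \<in> vecs" "qf u = \<zero>" "bil u v = \<zero>"
  shows "A \<otimes>\<^bsub>G\<^esub> eich u v \<otimes>\<^bsub>G\<^esub> inv\<^bsub>G\<^esub> A = eich (A \<bullet> u) (A \<bullet> v)"
  by (rule G_eqI) (use assms in \<open>simp_all add: act_eich bil_inv\<close>)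

text \<open>With both vectors isotropic the quadratic term disappears, and what is added to w,
  namely <v, w>u - <u, w>v, is skew in u and v.\<close>

lemma eich_swap:
  assumes "u \<in> vecs" "v \<in> vecs" "qf u = \<zero>" "qf v = \<zero>" "bil u v = \<zero>"
  shows "eich u v = eich v ((\<ominus> \<one>) \<odot>\<^sub>v u)"
proof (rule mat_eq_actI)
  fix w assume w: "w \<in> vecs"
  show "eich u v \<bullet> w = eich v ((\<ominus> \<one>) \<odot>\<^sub>v u) \<bullet> w"
    using assms w by (intro vec_eqI) (simp_all add: act_eich l_minus minus_eq r_minus a_ac)
qed (use assms in simp_all)

lemma eich_smul_ring:
  assumes "a \<in> carrier R" "x \<in> carrier R" "y \<in> carrier R" "Q \<in> carrier R" "u \<in> carrier R" "v \<in> carrier R" "w \<in> carrier R"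
  shows "w \<oplus> (y \<ominus> Q \<otimes> (a \<otimes> x)) \<otimes> (a \<otimes> u) \<oplus> \<ominus> (a \<otimes> x) \<otimes> v
    = w \<oplus> (a \<otimes> y \<ominus> a \<otimes> a \<otimes> Q \<otimes> x) \<otimes> u \<oplus> \<ominus> x \<otimes> (a \<otimes> v)"
  using assms by algebra

lemma eich_smul:
  assumes "a \<in> carrier R" "u \<in> vecs" "v \<in> vecs"
  shows "eich (a \<odot>\<^sub>v u) v = eich u (a \<odot>\<^sub>v v)"
proof (rule mat_eq_actI)
  fix w assume w: "w \<in> vecs"
  show "eich (a \<odot>\<^sub>v u) v \<bullet> w = eich u (a \<odot>\<^sub>v v) \<bullet> w"
    using assms w by (intro vec_eqI) (simp_all add: act_eich eich_smul_ring del: smul_smul)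
qed (use assms in simp_all)

text \<open>The terms <cu, w>u and <u, w>cu cancel, and q(cu) = 0.\<close>

lemma eich_self:
  assumes "c \<in> carrier R" "u \<in> vecs" "qf u = \<zero>"
  shows "eich u (c \<odot>\<^sub>v u) = \<one>\<^bsub>G\<^esub>"
proof (rule G_eqI)
  fix w assume w: "w \<in> vecs"
  show "eich u (c \<odot>\<^sub>v u) \<bullet> w = \<one>\<^bsub>G\<^esub> \<bullet> w"
    using assms w by (intro vec_eqI) (simp_all add: act_eich l_minus r_minus minus_eq m_ac a_ac r_neg)
qed (use assms in \<open>simp_all add: bil_self\<close>)

section \<open>Matrix transvections as Eichler transformations\<close>

lemma mat_add_apply: "i \<in> Omega n \<Longrightarrow> j \<in> Omega n \<Longrightarrow> (A \<oplus>\<^bsub>mat_ring R (Omega n)\<^esub> B) (i, j) = A (i, j) \<oplus> B (i, j)"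
  by (simp add: mat_ring_def)

lemma mat_zero_apply: "i \<in> Omega n \<Longrightarrow> j \<in> Omega n \<Longrightarrow> \<zero>\<^bsub>mat_ring R (Omega n)\<^esub> (i, j) = \<zero>"
  by (simp add: mat_ring_def)

lemma mat_zero_closed [simp]: "\<zero>\<^bsub>mat_ring R (Omega n)\<^esub> \<in> mats"
  by (auto simp: mat_ring_def mats_def)

lemma mat_add_closed [simp]: "A \<in> mats \<Longrightarrow> B \<in> mats \<Longrightarrow> A \<oplus>\<^bsub>mat_ring R (Omega n)\<^esub> B \<in> mats"
proof -
  assume AB: "A \<in> mats" "B \<in> mats"
  then have "A (i, j) \<oplus> B (i, j) \<in> carrier R" if "i \<in> Omega n" "j \<in> Omega n" for i j
    using that by simp
  then show ?thesis unfolding mats_def by (auto simp: mat_ring_def)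
qed

text \<open>\<open>transv\<close> subtracts inside the matrix ring. The additive group structure
  identifies that negation with the entrywise one.\<close>

sublocale mat_ring: abelian_group "mat_ring R (Omega n)"
proof (rule abelian_groupI)
  fix x assume "x \<in> carrier (mat_ring R (Omega n))"
  then have x: "x \<in> mats" by simp
  let ?y = "\<lambda>(i, j)\<in>Omega n \<times> Omega n. \<ominus> x (i, j)"
  have y: "?y \<in> mats" using x by (auto simp: mats_def)
  have "?y \<oplus>\<^bsub>mat_ring R (Omega n)\<^esub> x = \<zero>\<^bsub>mat_ring R (Omega n)\<^esub>"
    by (rule mat_eqI) (use x y in \<open>simp_all add: mat_add_apply mat_zero_apply l_neg\<close>)
  then show "\<exists>y\<in>carrier (mat_ring R (Omega n)). y \<oplus>\<^bsub>mat_ring R (Omega n)\<^esub> x = \<zero>\<^bsub>mat_ring R (Omega n)\<^esub>"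
    using y by (intro bexI[of _ ?y]) simp_all
  show "\<zero>\<^bsub>mat_ring R (Omega n)\<^esub> \<oplus>\<^bsub>mat_ring R (Omega n)\<^esub> x = x"
    by (rule mat_eqI) (use x in \<open>simp_all add: mat_add_apply mat_zero_apply\<close>)
  fix y assume "y \<in> carrier (mat_ring R (Omega n))"
  then have y: "y \<in> mats" by simp
  show "x \<oplus>\<^bsub>mat_ring R (Omega n)\<^esub> y = y \<oplus>\<^bsub>mat_ring R (Omega n)\<^esub> x"
    by (rule mat_eqI) (use x y in \<open>simp_all add: mat_add_apply a_comm\<close>)
  fix z assume "z \<in> carrier (mat_ring R (Omega n))"
  then have z: "z \<in> mats" by simp
  show "x \<oplus>\<^bsub>mat_ring R (Omega n)\<^esub> y \<oplus>\<^bsub>mat_ring R (Omega n)\<^esub> z = x \<oplus>\<^bsub>mat_ring R (Omega n)\<^esub> (y \<oplus>\<^bsub>mat_ring R (Omega n)\<^esub> z)"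
    by (rule mat_eqI) (use x y z in \<open>simp_all add: mat_add_apply a_assoc\<close>)
qed simp_all

lemma unit_mat_mats [simp]: "x \<in> carrier R \<Longrightarrow> unit_mat R n x i j \<in> mats"
  by (auto simp: unit_mat_def mats_def)

lemma unit_mat_apply:
  "k \<in> Omega n \<Longrightarrow> l \<in> Omega n \<Longrightarrow> unit_mat R n x i j (k, l) = (if k = i \<and> l = j then x else \<zero>)"
  by (simp add: unit_mat_def)

text \<open>In \<open>eich_apply\<close> the column index enters as -b, so the vector paired with
  e_i must sit at position -j. Being a multiple of a basis vector it is isotropic, and no quadratic
  term remains.\<close>

lemma transv_eich:
  assumes "i \<in> Omega n" "j \<in> Omega n" "i \<noteq> j" "i \<noteq> - j" "x \<in> carrier R"
  shows "transv R n i j x = eich (ax i \<one>) (ax (- j) x)"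
proof -
  have "\<ominus>\<^bsub>mat_ring R (Omega n)\<^esub> unit_mat R n x (- j) (- i) = unit_mat R n (\<ominus> x) (- j) (- i)"
  proof (rule mat_ring.minus_equality)
    show "unit_mat R n (\<ominus> x) (- j) (- i) \<oplus>\<^bsub>mat_ring R (Omega n)\<^esub> unit_mat R n x (- j) (- i) = \<zero>\<^bsub>mat_ring R (Omega n)\<^esub>"
      by (rule mat_eqI) (use assms in \<open>simp_all add: mat_add_apply mat_zero_apply unit_mat_apply l_neg\<close>)
  qed (use assms in simp_all)
  then have "transv R n i j x = \<one>\<^bsub>mat_ring R (Omega n)\<^esub> \<oplus>\<^bsub>mat_ring R (Omega n)\<^esub> unit_mat R n x i j
      \<oplus>\<^bsub>mat_ring R (Omega n)\<^esub> unit_mat R n (\<ominus> x) (- j) (- i)"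
    by (simp add: transv_def a_minus_def)
  also have "\<dots> = eich (ax i \<one>) (ax (- j) x)"
  proof (rule mat_eqI)
    fix a b assume ab: "a \<in> Omega n" "b \<in> Omega n"
    have "- a = - b \<longleftrightarrow> a = b" "- b = i \<longleftrightarrow> b = - i" "- b = - j \<longleftrightarrow> b = j" by auto
    then show "(\<one>\<^bsub>mat_ring R (Omega n)\<^esub> \<oplus>\<^bsub>mat_ring R (Omega n)\<^esub> unit_mat R n x i j
      \<oplus>\<^bsub>mat_ring R (Omega n)\<^esub> unit_mat R n (\<ominus> x) (- j) (- i)) (a, b) = eich (ax i \<one>) (ax (- j) x) (a, b)"
      using assms ab by (simp add: mat_add_apply eich_apply mat_one_apply unit_mat_apply minus_eq)
  qed (use assms mat_ring.add.m_closed in simp_all)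
  finally show ?thesis .
qed

subsection \<open>Elementary transvections\<close>

text \<open>\<open>el i j x\<close> is the transvection \<open>T\<^bsub>i,-j\<^esub>(x)\<close>; with this indexing it is antisymmetric in \<open>i\<close> and \<open>j\<close>.\<close>

definition el where "el i j x = eich (ax i \<one>) (ax j x)"
definition trunc where "trunc A v = (\<lambda>i\<in>Omega n. if i \<in> A then v i else \<zero>)"
definition vsum where "vsum f A = (\<lambda>i\<in>Omega n. \<Oplus>k\<in>A. f k i)"

lemma el_closed [simp]:
  "i \<in> Omega n \<Longrightarrow> j \<in> Omega n \<Longrightarrow> i \<noteq> - j \<Longrightarrow> x \<in> carrier R \<Longrightarrow> el i j x \<in> carrier G"
  unfolding el_def by (intro eich_closed) auto

lemma eich_ax: "c \<in> carrier R \<Longrightarrow> d \<in> carrier R \<Longrightarrow> eich (ax i c) (ax j d) = el i j (c \<otimes> d)"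
  using eich_smul[of c "ax i \<one>" "ax j d"] by (simp add: el_def)

lemma trunc_apply [simp]: "i \<in> Omega n \<Longrightarrow> trunc A v i = (if i \<in> A then v i else \<zero>)"
  by (simp add: trunc_def)

lemma trunc_closed [simp]: "v \<in> vecs \<Longrightarrow> trunc A v \<in> vecs"
proof -
  assume "v \<in> vecs"
  then have "(if i \<in> A then v i else \<zero>) \<in> carrier R" if "i \<in> Omega n" for i using that by simp
  then show ?thesis by (auto simp: trunc_def vecs_def)
qed

lemma trunc_insert: "v \<in> vecs \<Longrightarrow> i \<notin> A \<Longrightarrow> trunc (insert i A) v = ax i (v i) \<oplus>\<^sub>v trunc A v" if "i \<in> Omega n"
  using that by (intro vec_eqI) auto

lemma vsum_apply [simp]: "i \<in> Omega n \<Longrightarrow> vsum f A i = (\<Oplus>k\<in>A. f k i)"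
  by (simp add: vsum_def)

lemma vsum_closed [simp]: "f \<in> A \<rightarrow> vecs \<Longrightarrow> vsum f A \<in> vecs"
proof -
  assume "f \<in> A \<rightarrow> vecs"
  then have "(\<Oplus>k\<in>A. f k i) \<in> carrier R" if "i \<in> Omega n" for i
    using that by (intro finsum_closed) (auto simp: Pi_def)
  then show ?thesis by (auto simp: vsum_def vecs_def)
qed

lemma vsum_insert:
  "finite A \<Longrightarrow> k \<notin> A \<Longrightarrow> f \<in> insert k A \<rightarrow> vecs \<Longrightarrow> vsum f (insert k A) = f k \<oplus>\<^sub>v vsum f A"
  by (rule vec_eqI) (auto simp: Pi_def)

lemma vsum_induct:
  assumes "finite A" "\<And>k. k \<in> A \<Longrightarrow> P (f k)" "P (ax 1 \<zero>)" "\<And>u v. P u \<Longrightarrow> P v \<Longrightarrow> P (u \<oplus>\<^sub>v v)"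
    "\<And>v. P v \<Longrightarrow> v \<in> vecs"
  shows "P (vsum f A)"
  using assms(1,2)
proof (induction A rule: finite_induct)
  case empty
  \<comment> \<open>\<open>ax 1 \<zero>\<close> serves as the zero column, whether or not 1 lies in
    \<open>Omega n\<close>.\<close>
  have "vsum f {} = ax 1 \<zero>" by (auto simp: vsum_def ax_def)
  then show ?case using assms(3) by simp
next
  case (insert k A)
  then have "P (f k)" "P (vsum f A)" by auto
  moreover have "vsum f (insert k A) = f k \<oplus>\<^sub>v vsum f A"
    using insert assms(5) by (intro vsum_insert) auto
  ultimately show ?case using assms(4) by simp
qed

lemma smul_vsum: "c \<in> carrier R \<Longrightarrow> f \<in> A \<rightarrow> vecs \<Longrightarrow> c \<odot>\<^sub>v vsum f A = vsum (\<lambda>k. c \<odot>\<^sub>v f k) A"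
proof (cases "finite A")
  case True
  assume "c \<in> carrier R" "f \<in> A \<rightarrow> vecs"
  then show ?thesis using True
    by (intro vec_eqI) (simp_all add: finsum_rdistr Pi_def)
next
  case False
  assume "c \<in> carrier R"
  then show ?thesis using False by (auto simp: smul_def vsum_def add.finprod_infinite[OF False])
qed

text \<open>Swapping the arguments reduces this to additivity on the right; the swap is the reason
  for requiring v to be isotropic.\<close>

lemma eich_add_left:
  assumes "u \<in> vecs" "u' \<in> vecs" "v \<in> vecs" "qf u = \<zero>" "qf u' = \<zero>" "qf v = \<zero>"
    "bil u v = \<zero>" "bil u' v = \<zero>" "bil u u' = \<zero>"
  shows "eich (u \<oplus>\<^sub>v u') v = eich u v \<otimes>\<^bsub>G\<^esub> eich u' v"
proof -
  have b: "bil v u = \<zero>" "bil v u' = \<zero>" using assms by (simp_all add: bil_sym[of v])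
  have "eich (u \<oplus>\<^sub>v u') v = eich v ((\<ominus> \<one>) \<odot>\<^sub>v (u \<oplus>\<^sub>v u'))"
    using assms by (intro eich_swap) simp_all
  also have "\<dots> = eich v ((\<ominus> \<one>) \<odot>\<^sub>v u) \<otimes>\<^bsub>G\<^esub> eich v ((\<ominus> \<one>) \<odot>\<^sub>v u')"
    using assms b by (simp add: smul_vadd eich_add)
  also have "\<dots> = eich u v \<otimes>\<^bsub>G\<^esub> eich u' v" using assms by (simp add: eich_swap[of u v] eich_swap[of u' v])
  finally show ?thesis .
qed

text \<open>Split y into coordinates. With z the plane vector, each factor E(z, y_i e_i) = E(y_i
  e_i, -z) is a product of transvections with parameters -y_i a and -y_i b. Since the ideal
  condition concerns these products only, either z or y may carry the ideal. It is used both for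
  EO(R, I) and for EO(R).\<close>

lemma eich_plane_in:
  assumes X: "subgroup X G" and J: "ideal J R"
    and el: "\<And>i j x. i \<in> Omega n \<Longrightarrow> j \<in> Omega n \<Longrightarrow> i \<noteq> j \<Longrightarrow> i \<noteq> - j \<Longrightarrow> x \<in> J \<Longrightarrow> el i j x \<in> X"
    and kl: "k \<in> Omega n" "l \<in> Omega n" "k \<noteq> - l"
    and ab: "a \<in> carrier R" "b \<in> carrier R"
    and y: "y \<in> vecs" "y (- k) = \<zero>" "y (- l) = \<zero>"
    and yJ: "\<And>i. i \<in> Omega n \<Longrightarrow> a \<otimes> y i \<in> J" "\<And>i. i \<in> Omega n \<Longrightarrow> b \<otimes> y i \<in> J"
  shows "eich (ax k a \<oplus>\<^sub>v ax l b) y \<in> X"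
proof -
  interpret J: ideal J R by (rule J)
  let ?z = "ax k a \<oplus>\<^sub>v ax l b"
  have z: "?z \<in> vecs" "qf ?z = \<zero>" using kl ab by auto
  \<comment> \<open>The degenerate case i = j is harmless, since E(e_i, t e_i) is the
    identity.\<close>
  have el': "el i j (c \<otimes> d) \<in> X"
    if "i \<in> Omega n" "j \<in> Omega n" "i \<noteq> - j" "c \<in> carrier R" "d \<in> carrier R" "c \<otimes> d \<in> J" for i j c d
  proof (cases "i = j")
    case True
    then show ?thesis using that eich_self[of "c \<otimes> d" "ax j \<one>"] subgroup.one_closed[OF X] by (simp add: el_def)
  qed (use that el in simp)
  \<comment> \<open>At i = -k and i = -l the basis vector need not be orthogonal to z, but there y
    has entry zero.\<close>
  have ax: "bil ?z (ax i (y i)) = \<zero> \<and> eich ?z (ax i (y i)) \<in> X" if i: "i \<in> Omega n" for i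
  proof (cases "i = - k \<or> i = - l")
    case True
    then have "y i = \<zero>" using y by auto
    then have "ax i (y i) = \<zero> \<odot>\<^sub>v ?z" using z kl ab by (intro vec_eqI) auto
    then show ?thesis using z eich_self[of \<zero> ?z] subgroup.one_closed[OF X] by (simp add: bil_self)
  next
    case False
    have yi: "y i \<in> carrier R" using y i by simp
    have b: "bil (ax i (y i)) (ax k (\<ominus> a)) = \<zero>" "bil (ax i (y i)) (ax l (\<ominus> b)) = \<zero>" "bil ?z (ax i (y i)) = \<zero>"
      using False i yi ab kl by auto
    have "eich ?z (ax i (y i)) = eich (ax i (y i)) ((\<ominus> \<one>) \<odot>\<^sub>v ?z)"
      using z yi b by (intro eich_swap) simp_all
    also have "(\<ominus> \<one>) \<odot>\<^sub>v ?z = ax k (\<ominus> a) \<oplus>\<^sub>v ax l (\<ominus> b)" using ab by (simp add: smul_vadd l_minus)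
    also have "eich (ax i (y i)) \<dots> = el i k (y i \<otimes> \<ominus> a) \<otimes>\<^bsub>G\<^esub> el i l (y i \<otimes> \<ominus> b)"
      using ab yi b by (simp add: eich_add eich_ax)
    also have "\<dots> \<in> X"
    proof (intro subgroup.m_closed[OF X] el')
      show "y i \<otimes> \<ominus> a \<in> J" "y i \<otimes> \<ominus> b \<in> J"
        using yJ[OF i] ab yi by (simp_all add: r_minus m_comm[of "y i"])
    qed (use False i kl ab yi in auto)
    finally show ?thesis using b by simp
  qed
  have "finite A \<Longrightarrow> A \<subseteq> Omega n \<Longrightarrow> bil ?z (trunc A y) = \<zero> \<and> eich ?z (trunc A y) \<in> X" for A
  proof (induction A rule: finite_induct)
    case empty
    have "trunc {} y = \<zero> \<odot>\<^sub>v ?z" using z y ab by (intro vec_eqI) auto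
    then show ?case using z eich_self[of \<zero> ?z] subgroup.one_closed[OF X] by (simp add: bil_self)
  next
    case (insert i A)
    then have "bil ?z (ax i (y i)) = \<zero> \<and> eich ?z (ax i (y i)) \<in> X" "bil ?z (trunc A y) = \<zero> \<and> eich ?z (trunc A y) \<in> X"
      using ax by auto
    moreover have "trunc (insert i A) y = ax i (y i) \<oplus>\<^sub>v trunc A y" "y i \<in> carrier R"
      using insert y by (auto intro: trunc_insert)
    ultimately show ?case using z y by (simp add: eich_add subgroup.m_closed[OF X] del: bil_vadd_left)
  qed
  moreover have "trunc (Omega n) y = y" using y by (intro vec_eqI) auto
  ultimately show ?thesis by (metis finite_Omega order_refl)
qed

text \<open>Passing through a hyperbolic pair \<open>e\<^bsub>m\<^esub>, e\<^bsub>-m\<^esub>\<close> orthogonal to both vectors is what makes the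
  transformations of a plane that are not visibly elementary into products of elementary ones.\<close>

lemma eich_commutator:
  assumes "z \<in> vecs" "y \<in> vecs" "qf z = \<zero>" "qf y = \<zero>" "bil z y = \<zero>" "m \<in> Omega n"
    "z m = \<zero>" "z (- m) = \<zero>" "y m = \<zero>" "y (- m) = \<zero>"
  shows "eich z y = eich z (ax m \<one>) \<otimes>\<^bsub>G\<^esub> eich (ax (- m) \<one>) y \<otimes>\<^bsub>G\<^esub> inv\<^bsub>G\<^esub> (eich z (ax m \<one>))
    \<otimes>\<^bsub>G\<^esub> inv\<^bsub>G\<^esub> (eich (ax (- m) \<one>) y)"
proof -
  let ?e = "ax m \<one>" and ?f = "ax (- m) \<one>"
  let ?A = "eich z ?e"
  have b: "bil z ?e = \<zero>" "bil ?f y = \<zero>" "bil z ?f = \<zero>" "bil ?f ?e = \<one>" "bil ?e ?f = \<one>" "bil ?e y = \<zero>" "bil y z = \<zero>" "bil ?f z = \<zero>"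
    using assms by (simp_all add: bil_sym[of y z])
  have A: "?A \<in> carrier G" using assms b by (intro eich_closed) simp_all
  have F: "eich ?f y \<in> carrier G" using assms b by (intro eich_closed) simp_all
  have zy: "eich z y \<in> carrier G" using assms b by (intro eich_closed) simp_all
  \<comment> \<open>E(z, e_m) fixes y and sends e_{-m} to z + e_{-m}; conjugating E(e_{-m}, y) by it
    therefore gives E(z, y) E(e_{-m}, y).\<close>
  have Af: "?A \<bullet> ?f = z \<oplus>\<^sub>v ?f"
    by (rule vec_eqI) (use assms b A in \<open>simp_all add: act_eich minus_eq a_comm\<close>)
  have Ay: "?A \<bullet> y = y"
    by (rule vec_eqI) (use assms b A in \<open>simp_all add: act_eich minus_eq\<close>)
  have "?A \<otimes>\<^bsub>G\<^esub> eich ?f y \<otimes>\<^bsub>G\<^esub> inv\<^bsub>G\<^esub> ?A = eich (z \<oplus>\<^sub>v ?f) y"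
    using eich_conj[of ?A ?f y] A assms b by (simp add: Af Ay)
  also have "\<dots> = eich z y \<otimes>\<^bsub>G\<^esub> eich ?f y"
    using assms b by (intro eich_add_left) simp_all
  finally show ?thesis using F zy by (simp add: G.m_assoc)
qed

lemma EO_subgroup: "subgroup (EO R n) G"
  unfolding EO_def EO_ideal_def by (rule G.generate_is_subgroup) (auto simp: transv_eich intro!: eich_closed)

lemma transv_el: "i \<in> Omega n \<Longrightarrow> j \<in> Omega n \<Longrightarrow> i \<noteq> j \<Longrightarrow> i \<noteq> - j \<Longrightarrow> x \<in> carrier R \<Longrightarrow> transv R n i j x = el i (- j) x"
  by (simp add: transv_eich el_def)

lemma el_EO_ideal:
  assumes "I \<subseteq> carrier R" "i \<in> Omega n" "j \<in> Omega n" "i \<noteq> j" "i \<noteq> - j" "x \<in> I"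
  shows "el i j x \<in> EO_ideal R n I"
proof -
  have "el i j x = transv R n i (- j) x" using assms by (subst transv_el) auto
  moreover have "transv R n i (- j) x \<in> {transv R n i j x |i j x. i \<in> Omega n \<and> j \<in> Omega n \<and> i \<noteq> j \<and> i \<noteq> - j \<and> x \<in> I}"
    by (rule CollectI, rule exI[of _ i], rule exI[of _ "- j"], rule exI[of _ x]) (use assms in auto)
  ultimately show ?thesis unfolding EO_ideal_def by (simp add: generate.incl)
qed

lemma EO_ideal_subset:
  assumes "I \<subseteq> carrier R" "subgroup X G"
    "\<And>i j x. i \<in> Omega n \<Longrightarrow> j \<in> Omega n \<Longrightarrow> i \<noteq> j \<Longrightarrow> i \<noteq> - j \<Longrightarrow> x \<in> I \<Longrightarrow> el i j x \<in> X"
  shows "EO_ideal R n I \<subseteq> X"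
  unfolding EO_ideal_def
proof (rule G.generate_subgroup_incl[OF _ assms(2)])
  show "{transv R n i j x |i j x. i \<in> Omega n \<and> j \<in> Omega n \<and> i \<noteq> j \<and> i \<noteq> - j \<and> x \<in> I} \<subseteq> X"
  proof
    fix A assume "A \<in> {transv R n i j x |i j x. i \<in> Omega n \<and> j \<in> Omega n \<and> i \<noteq> j \<and> i \<noteq> - j \<and> x \<in> I}"
    then obtain i j x where ij: "i \<in> Omega n" "j \<in> Omega n" "i \<noteq> j" "i \<noteq> - j" "x \<in> I" and A: "A = transv R n i j x"
      by blast
    have "A = el i (- j) x" using ij A assms(1) by (auto simp: transv_el)
    then show "A \<in> X" using assms(3)[of i "- j" x] ij by auto
  qed
qed

lemma el_EO [simp]:
  assumes "i \<in> Omega n" "j \<in> Omega n" "i \<noteq> j" "i \<noteq> - j" "x \<in> carrier R"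
  shows "el i j x \<in> EO R n"
  using assms el_EO_ideal[of "carrier R"] by (simp add: EO_def)

text \<open>The Koszul syzygies of the linear form \<open>\<langle>u, -\<rangle>\<close>.\<close>

definition syz where "syz u k l = ax k (u (- l)) \<oplus>\<^sub>v ax l (\<ominus> u (- k))"

lemma syz_closed [simp]: "u \<in> vecs \<Longrightarrow> k \<in> Omega n \<Longrightarrow> l \<in> Omega n \<Longrightarrow> syz u k l \<in> vecs"
  by (simp add: syz_def)

lemma bil_syz [simp]: "u \<in> vecs \<Longrightarrow> k \<in> Omega n \<Longrightarrow> l \<in> Omega n \<Longrightarrow> bil u (syz u k l) = \<zero>"
proof -
  assume *: "u \<in> vecs" "k \<in> Omega n" "l \<in> Omega n"
  have "bil u (syz u k l) = u (- l) \<otimes> u (- k) \<oplus> \<ominus> u (- k) \<otimes> u (- l)" using * by (simp add: syz_def)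
  also have "\<ominus> u (- k) \<otimes> u (- l) = \<ominus> (u (- l) \<otimes> u (- k))"
    using * m_comm[of "u (- l)" "u (- k)"] by (subst l_minus) simp_all
  finally show ?thesis using * by (simp add: r_neg)
qed

lemma vsum_ax_ring:
  assumes "a \<in> carrier R" "b \<in> carrier R" "c \<in> carrier R"
  shows "a \<otimes> ((if P then b else \<zero>) \<oplus> (if Q then \<ominus> c else \<zero>)) = (if P then a \<otimes> b else \<zero>) \<oplus> (if Q then \<ominus> \<one> else \<zero>) \<otimes> (a \<otimes> c)"
  using assms by (simp add: r_distr r_minus l_minus)

text \<open>Since \<open>syz u k (- t)\<close> is u_t e_k - u_{-k} e_{-t}, the first terms add up to
  u_t v and the coefficient of e_{-t} adds up to -<v, u> = 0.\<close>

lemma koszul: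
  assumes "u \<in> vecs" "v \<in> vecs" "bil u v = \<zero>" "t \<in> Omega n"
  shows "vsum (\<lambda>k. v k \<odot>\<^sub>v syz u k (- t)) (Omega n) = u t \<odot>\<^sub>v v"
proof (rule vec_eqI)
  fix i assume i: "i \<in> Omega n"
  let ?d = "if i = - t then \<ominus> \<one> else \<zero>"
  have "vsum (\<lambda>k. v k \<odot>\<^sub>v syz u k (- t)) (Omega n) i
      = (\<Oplus>k\<in>Omega n. (if k = i then v k \<otimes> u t else \<zero>) \<oplus> ?d \<otimes> (v k \<otimes> u (- k)))"
    unfolding vsum_apply[OF i] using assms i
    by (intro finsum_cong') (auto simp: syz_def vsum_ax_ring r_distr r_minus l_minus)
  also have "\<dots> = (\<Oplus>k\<in>Omega n. if k = i then v k \<otimes> u t else \<zero>) \<oplus> (\<Oplus>k\<in>Omega n. ?d \<otimes> (v k \<otimes> u (- k)))"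
    using assms i by (intro finsum_addf) auto
  also have "(\<Oplus>k\<in>Omega n. ?d \<otimes> (v k \<otimes> u (- k))) = ?d \<otimes> bil v u"
    unfolding bil_def using assms by (intro finsum_rdistr[symmetric]) auto
  also have "bil v u = \<zero>" using assms bil_zero_sym by simp
  also have "(\<Oplus>k\<in>Omega n. if k = i then v k \<otimes> u t else \<zero>) = v i \<otimes> u t"
    using assms i by (intro finsum_delta) auto
  finally show "vsum (\<lambda>k. v k \<odot>\<^sub>v syz u k (- t)) (Omega n) i = (u t \<odot>\<^sub>v v) i"
    using assms i by (simp add: m_comm)
qed (use assms in \<open>auto intro!: vsum_closed\<close>)

text \<open>Expanding <u, w> = 1 writes v as a combination of the multiples u_t v, to which
  \<open>koszul\<close> applies.\<close>

lemma unimodular_vsum: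
  assumes "u \<in> vecs" "v \<in> vecs" "w \<in> vecs" "bil u w = \<one>"
  shows "vsum (\<lambda>t. w (- t) \<odot>\<^sub>v u t \<odot>\<^sub>v v) (Omega n) = v"
proof (rule vec_eqI)
  fix i assume i: "i \<in> Omega n"
  have "vsum (\<lambda>t. w (- t) \<odot>\<^sub>v u t \<odot>\<^sub>v v) (Omega n) i = (\<Oplus>t\<in>Omega n. (u t \<otimes> w (- t)) \<otimes> v i)"
    unfolding vsum_apply[OF i] using assms i by (intro finsum_cong') (auto simp: m_comm)
  also have "\<dots> = bil u w \<otimes> v i"
    unfolding bil_def using assms i by (intro finsum_ldistr[symmetric]) auto
  finally show "vsum (\<lambda>t. w (- t) \<odot>\<^sub>v u t \<odot>\<^sub>v v) (Omega n) i = v i" using assms i by simp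
qed (use assms in \<open>auto intro!: vsum_closed\<close>)

text \<open>Supplies a hyperbolic pair orthogonal to two given ones; this is the main use of the
  bound on n.\<close>

lemma third_index:
  assumes "3 \<le> n"
  obtains m where "m \<in> Omega n" "m \<noteq> k" "m \<noteq> - k" "m \<noteq> l" "m \<noteq> - l"
proof -
  have "\<exists>m\<in>{1, 2, 3 :: int}. m \<noteq> k \<and> m \<noteq> - k \<and> m \<noteq> l \<and> m \<noteq> - l" by auto
  then obtain m where "m \<in> {1, 2, 3}" "m \<noteq> k \<and> m \<noteq> - k \<and> m \<noteq> l \<and> m \<noteq> - l" by blast
  then show ?thesis using assms by (intro that[of m]) (auto simp: Omega_def)
qed

end

subsection \<open>The relative elementary group\<close>

locale relative = orthogonal R n + ideal I R for R (structure) and n I +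
  assumes n3: "3 \<le> n"
begin

abbreviation N where "N \<equiv> EO_rel R n I"

lemma I_subset: "I \<subseteq> carrier R" using a_subset .

lemma I_carrier [simp]: "x \<in> I \<Longrightarrow> x \<in> carrier R" using I_subset by blast

lemma EO_ideal_sub_EO: "EO_ideal R n I \<subseteq> EO R n"
  using I_subset by (intro EO_ideal_subset[OF _ EO_subgroup]) auto

lemma EO_group: "group (G\<lparr>carrier := EO R n\<rparr>)"
  using EO_subgroup by (rule subgroup.subgroup_is_group) (rule G.is_group)

lemma N_normal: "N \<lhd> G\<lparr>carrier := EO R n\<rparr>"
  unfolding EO_rel_def using EO_ideal_sub_EO by (intro group.normal_closure_normal[OF EO_group]) simp

lemma N_sub_EO: "N \<subseteq> EO R n"
  using subgroup.subset[OF normal_imp_subgroup[OF N_normal]] by simp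

lemma N_subgroup: "subgroup N G"
  using G.incl_subgroup[OF EO_subgroup normal_imp_subgroup[OF N_normal]] .

lemma N_conj: "g \<in> EO R n \<Longrightarrow> x \<in> N \<Longrightarrow> g \<otimes>\<^bsub>G\<^esub> x \<otimes>\<^bsub>G\<^esub> inv\<^bsub>G\<^esub> g \<in> N"
  using group.normal_inv_iff[OF EO_group, of N] N_normal G.m_inv_consistent[OF EO_subgroup, of g]
  by auto

lemma EO_ideal_sub_N: "EO_ideal R n I \<subseteq> N"
  by (auto simp: EO_rel_def normal_closure_def)

lemma el_N: "i \<in> Omega n \<Longrightarrow> j \<in> Omega n \<Longrightarrow> i \<noteq> j \<Longrightarrow> i \<noteq> - j \<Longrightarrow> x \<in> I \<Longrightarrow> el i j x \<in> N"
  using el_EO_ideal[OF I_subset] EO_ideal_sub_N by blast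

text \<open>\<open>H\<close> need not lie in EO(R), so the normal subgroup compared with the closure
  is the intersection of \<open>H\<close> with EO(R).\<close>

lemma N_least:
  assumes H: "subgroup H G" and el: "\<And>i j x. i \<in> Omega n \<Longrightarrow> j \<in> Omega n \<Longrightarrow> i \<noteq> j \<Longrightarrow> i \<noteq> - j \<Longrightarrow> x \<in> I \<Longrightarrow> el i j x \<in> H"
    and conj: "\<And>g h. g \<in> EO R n \<Longrightarrow> h \<in> H \<Longrightarrow> g \<otimes>\<^bsub>G\<^esub> h \<otimes>\<^bsub>G\<^esub> inv\<^bsub>G\<^esub> g \<in> H"
  shows "N \<subseteq> H"
proof -
  let ?K = "H \<inter> EO R n"
  have K: "subgroup ?K G" using G.subgroups_Inter_pair H EO_subgroup by blast
  then have K': "subgroup ?K (G\<lparr>carrier := EO R n\<rparr>)" by (intro G.subgroup_incl EO_subgroup) simp_all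
  have "?K \<lhd> G\<lparr>carrier := EO R n\<rparr>"
    unfolding group.normal_inv_iff[OF EO_group]
    using K' conj G.m_inv_consistent[OF EO_subgroup] subgroup.m_closed[OF EO_subgroup] subgroup.m_inv_closed[OF EO_subgroup]
    by auto
  moreover have "EO_ideal R n I \<subseteq> ?K"
    using el EO_ideal_sub_EO by (intro Int_greatest EO_ideal_subset I_subset H EO_subgroup) auto
  ultimately show ?thesis by (auto simp: EO_rel_def normal_closure_def)
qed

text \<open>Coordinates of y away from -k and -l are handled by \<open>eich_plane_in\<close>. The
  rest, y1, lies in the opposite isotropic plane; there E(z, y1) is a commutator of E(z, e_m) in
  EO(R, I) with E(e_{-m}, y1) in EO(R), so normality suffices.\<close>

lemma eich_N_plane:
  assumes kl: "k \<in> Omega n" "l \<in> Omega n" "k \<noteq> l" "k \<noteq> - l" and ab: "a \<in> I" "b \<in> I"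
    and y: "y \<in> vecs" "bil (ax k a \<oplus>\<^sub>v ax l b) y = \<zero>"
  shows "eich (ax k a \<oplus>\<^sub>v ax l b) y \<in> N"
proof -
  let ?z = "ax k a \<oplus>\<^sub>v ax l b"
  define y0 where "y0 = trunc (Omega n - {- k, - l}) y"
  define y1 where "y1 = ax (- k) (y (- k)) \<oplus>\<^sub>v ax (- l) (y (- l))"
  have abR [simp]: "a \<in> carrier R" "b \<in> carrier R" using ab by auto
  have yR [simp]: "y (- k) \<in> carrier R" "y (- l) \<in> carrier R" using y kl by auto
  have z: "?z \<in> vecs" "qf ?z = \<zero>" using kl by auto
  have y0: "y0 \<in> vecs" "bil ?z y0 = \<zero>" "y0 (- k) = \<zero>" "y0 (- l) = \<zero>"
    using y kl by (auto simp: y0_def)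
  have y1: "y1 \<in> vecs" "qf y1 = \<zero>" using y kl by (auto simp: y1_def)
  have y01: "y = y0 \<oplus>\<^sub>v y1"
    by (rule vec_eqI) (use y y0 y1 kl in \<open>auto simp: y0_def y1_def\<close>)
  have b1: "bil ?z y1 = \<zero>"
    using y(2) y0 y1 z unfolding y01 by (simp del: bil_vadd_left)
  have 0: "eich ?z y0 \<in> N"
    by (rule eich_plane_in[OF N_subgroup is_ideal el_N]) (use kl ab y0 in \<open>auto intro: I_r_closed\<close>)
  obtain m where m: "m \<in> Omega n" "m \<noteq> k" "m \<noteq> - k" "m \<noteq> l" "m \<noteq> - l"
    using third_index[OF n3] by blast
  let ?e = "ax m \<one>" and ?f = "ax (- m) \<one>"
  have A: "eich ?z ?e \<in> N"
    by (rule eich_plane_in[OF N_subgroup is_ideal el_N]) (use kl ab m in \<open>auto intro: I_r_closed\<close>)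
  have m0: "?z m = \<zero>" "?z (- m) = \<zero>" "y1 m = \<zero>" "y1 (- m) = \<zero>"
    using kl m by (auto simp: y1_def)
  have f1: "bil ?f y1 = \<zero>" using y1 m m0 by simp
  \<comment> \<open>After the swap, y1 plays the role of the plane vector in
    \<open>eich_plane_in\<close>, now over the unit ideal.\<close>
  have "eich ?f y1 = eich y1 ((\<ominus> \<one>) \<odot>\<^sub>v ?f)"
  proof -
    have "eich ?f y1 = eich ((\<ominus> \<one>) \<odot>\<^sub>v (\<ominus> \<one>) \<odot>\<^sub>v ?f) y1" by (simp add: l_minus)
    then show ?thesis using y1 f1 by (intro eich_swap) simp_all
  qed
  also have "\<dots> \<in> EO R n"
    unfolding y1_def
    by (rule eich_plane_in[OF EO_subgroup oneideal el_EO]) (use kl m y in auto)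
  finally have F: "eich ?f y1 \<in> EO R n" .
  have "eich ?z y1 = eich ?z ?e \<otimes>\<^bsub>G\<^esub> eich ?f y1 \<otimes>\<^bsub>G\<^esub> inv\<^bsub>G\<^esub> (eich ?z ?e) \<otimes>\<^bsub>G\<^esub> inv\<^bsub>G\<^esub> (eich ?f y1)"
    by (rule eich_commutator[OF z(1) y1(1) z(2) y1(2) b1 m(1) m0])
  also have "\<dots> \<in> N"
    using A F N_conj subgroup.m_inv_closed[OF N_subgroup] subgroup.mem_carrier[OF EO_subgroup]
    by (intro G.commutator_in[OF N_subgroup]) auto
  finally have "eich ?z y1 \<in> N" .
  moreover have "eich ?z y = eich ?z y0 \<otimes>\<^bsub>G\<^esub> eich ?z y1"
    unfolding y01 using z y0 y1 b1 by (intro eich_add) simp_all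
  ultimately show ?thesis using 0 by (simp add: subgroup.m_closed[OF N_subgroup])
qed

text \<open>Quantifying over all \<open>c\<close> in \<open>I\<close> makes this, for isotropic
  \<open>u\<close>, a submodule of the orthogonal complement of \<open>u\<close>; it is then enough
  to find generators in it.\<close>

definition good where
  "good u = {v \<in> vecs. bil u v = \<zero> \<and> (\<forall>c\<in>I. eich u (c \<odot>\<^sub>v v) \<in> N)}"

lemma good_add: "u \<in> vecs \<Longrightarrow> qf u = \<zero> \<Longrightarrow> v \<in> good u \<Longrightarrow> v' \<in> good u \<Longrightarrow> v \<oplus>\<^sub>v v' \<in> good u"
  by (auto simp: good_def smul_vadd eich_add subgroup.m_closed[OF N_subgroup])

lemma good_smul: "u \<in> vecs \<Longrightarrow> r \<in> carrier R \<Longrightarrow> v \<in> good u \<Longrightarrow> r \<odot>\<^sub>v v \<in> good u"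
  by (auto simp: good_def I_r_closed)

lemma good_self: "u \<in> vecs \<Longrightarrow> qf u = \<zero> \<Longrightarrow> u \<in> good u"
  by (auto simp: good_def bil_self eich_self subgroup.one_closed[OF N_subgroup])

lemma good_zero: "u \<in> vecs \<Longrightarrow> qf u = \<zero> \<Longrightarrow> ax i \<zero> \<in> good u"
proof -
  assume u: "u \<in> vecs" "qf u = \<zero>"
  have "ax i \<zero> = \<zero> \<odot>\<^sub>v u" using u by (intro vec_eqI) simp_all
  then show ?thesis using good_smul[OF u(1) _ good_self[OF u], of \<zero>] by simp
qed

text \<open>The syzygy lies in the isotropic plane of e_k and e_l. Multiplied by \<open>c\<close> it
  has coefficients in \<open>I\<close>, so after swapping the arguments \<open>eich_N_plane\<close>
  applies.\<close>

lemma good_syz: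
  assumes u: "u \<in> vecs" "qf u = \<zero>" and kl: "k \<in> Omega n" "l \<in> Omega n" "k \<noteq> l" "k \<noteq> - l"
  shows "syz u k l \<in> good u"
  unfolding good_def
proof (intro CollectI conjI ballI)
  fix c assume c: "c \<in> I"
  let ?z = "ax k (c \<otimes> u (- l)) \<oplus>\<^sub>v ax l (c \<otimes> \<ominus> u (- k))"
  have cs: "c \<odot>\<^sub>v syz u k l = ?z" using c u kl by (simp add: syz_def smul_vadd)
  have b: "bil u ?z = \<zero>" using c u kl by (simp flip: cs)
  have qz: "qf ?z = \<zero>" using c u kl by simp
  have z: "?z \<in> vecs" using c u kl by simp
  have b': "bil ?z ((\<ominus> \<one>) \<odot>\<^sub>v u) = \<zero>" using b u z bil_sym[of ?z u] by (simp del: bil_vadd_left bil_vadd_right)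
  have "eich u (c \<odot>\<^sub>v syz u k l) = eich ?z ((\<ominus> \<one>) \<odot>\<^sub>v u)"
    unfolding cs by (rule eich_swap) (fact u z qz b)+
  also have "\<dots> \<in> N"
    by (rule eich_N_plane[OF kl _ _ _ b']) (use c u kl in \<open>auto intro: I_r_closed\<close>)
  finally show "eich u (c \<odot>\<^sub>v syz u k l) \<in> N" .
qed (use u kl in simp_all)

lemma good_vsum:
  assumes "u \<in> vecs" "qf u = \<zero>" "finite A" "\<And>k. k \<in> A \<Longrightarrow> f k \<in> good u"
  shows "vsum f A \<in> good u"
proof (rule vsum_induct[OF assms(3), where P = "\<lambda>v. v \<in> good u"])
  show "v \<in> vecs" if "v \<in> good u" for v using that by (simp add: good_def)
qed (use assms good_zero good_add in auto)

text \<open>A local-global principle: the coordinates of a unimodular u generate the unit ideal, so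
  membership may be tested after multiplying by each u_t.\<close>

lemma good_unimodular:
  assumes u: "u \<in> vecs" "qf u = \<zero>" and w: "w \<in> vecs" "bil u w = \<one>"
    and v: "v \<in> vecs" "\<And>t. t \<in> Omega n \<Longrightarrow> u t \<odot>\<^sub>v v \<in> good u"
  shows "v \<in> good u"
proof -
  have "vsum (\<lambda>t. w (- t) \<odot>\<^sub>v u t \<odot>\<^sub>v v) (Omega n) \<in> good u"
    by (rule good_vsum[OF u], simp, rule good_smul[OF u(1) _ v(2)]) (use w in auto)
  then show ?thesis using unimodular_vsum[OF u(1) v(1) w] by simp
qed

lemma syz_same: "u \<in> vecs \<Longrightarrow> k \<in> Omega n \<Longrightarrow> syz u k k = ax k \<zero>"
  by (rule vec_eqI) (auto simp: syz_def r_neg)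

text \<open>The syzygy \<open>syz u m (-m)\<close> is not supported on an isotropic plane. The Koszul relation for \<open>v = u\<close>
  expresses its multiple by \<open>u\<^bsub>m\<^esub>\<close> through the other syzygies, since \<open>u\<close> itself acts trivially.\<close>

lemma smul_good_syz_opp:
  assumes u: "u \<in> vecs" "qf u = \<zero>" and m: "m \<in> Omega n"
  shows "u m \<odot>\<^sub>v syz u m (- m) \<in> good u"
proof -
  define f where "f = (\<lambda>k. u k \<odot>\<^sub>v syz u k (- m))"
  have f: "f k \<in> vecs" if "k \<in> Omega n" for k using that u m by (simp add: f_def)
  have "f k \<in> good u" if "k \<in> Omega n - {m}" for k
  proof (cases "k = - m")
    case True
    then show ?thesis using u m good_zero[OF u] by (simp add: f_def syz_same)
  next
    case False
    then show ?thesis unfolding f_def using u m that by (intro good_smul good_syz) auto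
  qed
  then have g: "vsum f (Omega n - {m}) \<in> good u" using u by (intro good_vsum) auto
  have "u m \<odot>\<^sub>v u = vsum f (Omega n)"
    unfolding f_def using u m by (intro koszul[symmetric]) (simp_all add: bil_self)
  also have "\<dots> = vsum f (insert m (Omega n - {m}))" using m by (simp add: insert_absorb)
  also have "\<dots> = f m \<oplus>\<^sub>v vsum f (Omega n - {m})" using f m by (intro vsum_insert) auto
  finally have um: "u m \<odot>\<^sub>v u = f m \<oplus>\<^sub>v vsum f (Omega n - {m})" .
  have "f m = (f m \<oplus>\<^sub>v vsum f (Omega n - {m})) \<oplus>\<^sub>v (\<ominus> \<one>) \<odot>\<^sub>v vsum f (Omega n - {m})"
    using f m by (intro vec_eqI) (auto simp: a_assoc l_minus r_neg Pi_def)
  also have "f m \<oplus>\<^sub>v vsum f (Omega n - {m}) = u m \<odot>\<^sub>v u" by (rule um[symmetric])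
  also have "u m \<odot>\<^sub>v u \<oplus>\<^sub>v (\<ominus> \<one>) \<odot>\<^sub>v vsum f (Omega n - {m}) \<in> good u"
    using u m g by (intro good_add good_smul good_self) auto
  finally show ?thesis by (simp add: f_def)
qed

lemma good_syz_opp:
  assumes u: "u \<in> vecs" "qf u = \<zero>" and w: "w \<in> vecs" "bil u w = \<one>" and m: "m \<in> Omega n"
  shows "syz u m (- m) \<in> good u"
proof (rule good_unimodular[OF u w])
  fix t assume t: "t \<in> Omega n"
  consider "t = m" | "t = - m" | "t \<noteq> m" "t \<noteq> - m" by blast
  then show "u t \<odot>\<^sub>v syz u m (- m) \<in> good u"
  proof cases
    case 1
    then show ?thesis using smul_good_syz_opp[OF u m] by simp
  next
    case 2
    have "u t \<odot>\<^sub>v syz u m (- m) = (\<ominus> \<one>) \<odot>\<^sub>v u (- m) \<odot>\<^sub>v syz u (- m) (- (- m))"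
      using u m 2 by (intro vec_eqI) (use Omega_nonzero[OF m] in \<open>auto simp: syz_def l_minus r_minus\<close>)
    also have "\<dots> \<in> good u"
      by (rule good_smul[OF u(1) _ smul_good_syz_opp[OF u]]) (use m in simp_all)
    finally show ?thesis .
  next
    case 3
    \<comment> \<open>The three-term relation among the syzygies for m, -m and -t: the two e_{-t}
      terms on the right cancel, and both syzygies there are supported on isotropic planes.\<close>
    have "u t \<odot>\<^sub>v syz u m (- m) = u m \<odot>\<^sub>v syz u m (- t) \<oplus>\<^sub>v (\<ominus> u (- m)) \<odot>\<^sub>v syz u (- m) (- t)"
      using u m t 3 by (intro vec_eqI) (auto simp: syz_def l_minus r_minus m_comm l_neg r_neg)
    also have "\<dots> \<in> good u"
      using u m t 3 by (intro good_add good_smul good_syz) auto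
    finally show ?thesis .
  qed
qed (use u m in simp)

lemma good_syz_all:
  assumes u: "u \<in> vecs" "qf u = \<zero>" and w: "w \<in> vecs" "bil u w = \<one>" and kl: "k \<in> Omega n" "l \<in> Omega n"
  shows "syz u k l \<in> good u"
proof -
  consider "k = l" | "l = - k" | "k \<noteq> l" "k \<noteq> - l" by fastforce
  then show ?thesis
    using good_syz_opp[OF u w kl(1)] good_syz[OF u kl] good_zero[OF u] syz_same[OF u(1) kl(1)]
    by cases auto
qed

text \<open>Combining \<open>unimodular_vsum\<close> with \<open>koszul\<close> writes v as the sum
  of w_{-t} v_k \<open>syz u k (- t)\<close> over all t and k. The coefficients lie in
  \<open>I\<close> because the v_k do, and all syzygies are good.\<close>

lemma eich_N:
  assumes u: "u \<in> vecs" "qf u = \<zero>" and w: "w \<in> vecs" "bil u w = \<one>"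
    and v: "v \<in> vecs" "bil u v = \<zero>" "\<And>k. k \<in> Omega n \<Longrightarrow> v k \<in> I"
  shows "eich u v \<in> N"
proof -
  \<comment> \<open>Orthogonality to u is carried along because additivity of E(u, -) requires
    it.\<close>
  define P where "P v \<longleftrightarrow> v \<in> vecs \<and> bil u v = \<zero> \<and> eich u v \<in> N" for v
  have z: "ax 1 \<zero> = \<zero> \<odot>\<^sub>v u" using u by (intro vec_eqI) simp_all
  have P0: "P (ax 1 \<zero>)"
    unfolding z using u eich_self[of \<zero> u] subgroup.one_closed[OF N_subgroup] by (simp add: P_def bil_self)
  have Padd: "P (v \<oplus>\<^sub>v v')" if "P v" "P v'" for v v'
    using that u by (simp add: P_def eich_add subgroup.m_closed[OF N_subgroup])
  have P1: "P ((w (- t) \<otimes> v k) \<odot>\<^sub>v syz u k (- t))" if "k \<in> Omega n" "t \<in> Omega n" for k t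
    using good_syz_all[OF u w, of k "- t"] that u w v by (simp add: P_def good_def I_l_closed)
  have P2: "P (vsum (\<lambda>k. (w (- t) \<otimes> v k) \<odot>\<^sub>v syz u k (- t)) (Omega n))" if "t \<in> Omega n" for t
    using that by (intro vsum_induct[where P = P] P0 Padd P1) (auto simp: P_def)
  have "w (- t) \<odot>\<^sub>v u t \<odot>\<^sub>v v = vsum (\<lambda>k. (w (- t) \<otimes> v k) \<odot>\<^sub>v syz u k (- t)) (Omega n)" if t: "t \<in> Omega n" for t
  proof -
    have "w (- t) \<odot>\<^sub>v u t \<odot>\<^sub>v v = vsum (\<lambda>k. w (- t) \<odot>\<^sub>v v k \<odot>\<^sub>v syz u k (- t)) (Omega n)"
      unfolding koszul[OF u(1) v(1,2) t, symmetric] using t u v w by (intro smul_vsum) auto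
    also have "\<dots> = vsum (\<lambda>k. (w (- t) \<otimes> v k) \<odot>\<^sub>v syz u k (- t)) (Omega n)"
      unfolding vsum_def
    proof (intro restrict_ext finsum_cong')
      fix i k assume "i \<in> Omega n" "k \<in> Omega n"
      then show "(w (- t) \<odot>\<^sub>v v k \<odot>\<^sub>v syz u k (- t)) i = ((w (- t) \<otimes> v k) \<odot>\<^sub>v syz u k (- t)) i"
        using t u v w by simp
    qed (use t u v w in auto)
    finally show ?thesis .
  qed
  then have "P (vsum (\<lambda>t. w (- t) \<odot>\<^sub>v u t \<odot>\<^sub>v v) (Omega n))"
    using P2 by (intro vsum_induct[where P = P] P0 Padd) (auto simp: P_def)
  then show ?thesis using unimodular_vsum[OF u(1) v(1) w] by (simp add: P_def)
qed

end

subsection \<open>Congruence subgroups\<close>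

context orthogonal
begin

text \<open>Apply both sides of the commutation relation to e_{-j}, which the transvection sends to
  e_{-j} + e_i, and cancel the common summand A e_{-j}.\<close>

lemma center_column:
  assumes "A \<in> mats" "i \<in> Omega n" "j \<in> Omega n" "i \<noteq> j" "i \<noteq> - j" "a \<in> Omega n"
    and comm: "A \<otimes>\<^bsub>G\<^esub> el i j \<one> = el i j \<one> \<otimes>\<^bsub>G\<^esub> A" and A: "A \<in> carrier G"
  shows "A (a, i) = (if a = i then A (- j, - j) else \<zero>) \<oplus> \<ominus> (if a = j then A (- i, - j) else \<zero>)"
proof -
  let ?w = "ax (- j) \<one>"
  have w: "?w \<in> vecs" by simp
  have Ew: "el i j \<one> \<bullet> ?w = ?w \<oplus>\<^sub>v ax i \<one>"
    by (rule vec_eqI) (use assms in \<open>auto simp: el_def act_eich minus_eq\<close>)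
  have "A \<bullet> el i j \<one> \<bullet> ?w = el i j \<one> \<bullet> A \<bullet> ?w"
    using arg_cong[OF comm, of "\<lambda>B. B \<bullet> ?w"] A assms(2-5) by simp
  then have "(A \<bullet> ?w) a \<oplus> (A \<bullet> ax i \<one>) a = (el i j \<one> \<bullet> A \<bullet> ?w) a"
    using assms w by (simp add: Ew flip: vadd_apply)
  also have "\<dots> = (A \<bullet> ?w) a \<oplus> ((if a = i then A (- j, - j) else \<zero>) \<oplus> \<ominus> (if a = j then A (- i, - j) else \<zero>))"
    using assms by (auto simp: el_def act_eich minus_eq act_ax a_assoc)
  finally show ?thesis using assms by (auto simp: act_ax)
qed

text \<open>With m avoiding the signs of both a and b, column b is seen to vanish off the diagonal
  at row a, and both diagonal entries equal the one at -m. Central matrices are thus scalar.\<close>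

lemma center_entries:
  assumes n: "3 \<le> n" and A: "A \<in> center G" and ab: "a \<in> Omega n" "b \<in> Omega n"
  shows "a \<noteq> b \<Longrightarrow> A (a, b) = \<zero>" "A (a, a) = A (b, b)"
proof -
  have AG: "A \<in> carrier G" "A \<in> mats" using A by (auto simp: center_def)
  have eq: "A (a, i) = (if a = i then A (- j, - j) else \<zero>) \<oplus> \<ominus> (if a = j then A (- i, - j) else \<zero>)"
    if "i \<in> Omega n" "j \<in> Omega n" "i \<noteq> j" "i \<noteq> - j" "a \<in> Omega n" for i j a
    using that AG A by (intro center_column) (auto simp: center_def)
  obtain m where m: "m \<in> Omega n" "m \<noteq> a" "m \<noteq> - a" "m \<noteq> b" "m \<noteq> - b"
    using third_index[OF n] by blast
  show "A (a, b) = \<zero>" if "a \<noteq> b" using eq[of b m a] that m ab by auto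
  have "A (i, i) = A (- m, - m)" if "i = a \<or> i = b" for i
    using eq[of i m i] that m ab AG by auto
  then show "A (a, a) = A (b, b)" by metis
qed

lemma scalar_center:
  assumes n: "3 \<le> n" and A: "A \<in> carrier G"
    and off: "\<And>a b. a \<in> Omega n \<Longrightarrow> b \<in> Omega n \<Longrightarrow> a \<noteq> b \<Longrightarrow> A (a, b) = \<zero>"
    and diag: "\<And>a b. a \<in> Omega n \<Longrightarrow> b \<in> Omega n \<Longrightarrow> A (a, a) = A (b, b)"
  shows "A \<in> center G"
proof -
  have 1: "1 \<in> Omega n" using n by (simp add: Omega_def)
  let ?c = "A (1, 1)"
  have c: "?c \<in> carrier R" using A 1 by simp
  have act: "A \<bullet> v = ?c \<odot>\<^sub>v v" if v: "v \<in> vecs" for v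
  proof (rule vec_eqI)
    fix i assume i: "i \<in> Omega n"
    have "(A \<bullet> v) i = (\<Oplus>k\<in>Omega n. if k = i then ?c \<otimes> v k else \<zero>)"
      unfolding act_apply[OF i] using i v c off diag[OF i 1] by (intro finsum_cong') auto
    also have "\<dots> = ?c \<otimes> v i" using i v c by (intro finsum_delta) auto
    finally show "(A \<bullet> v) i = (?c \<odot>\<^sub>v v) i" using i by simp
  qed (use A v c in simp_all)
  have "A \<otimes>\<^bsub>G\<^esub> g = g \<otimes>\<^bsub>G\<^esub> A" if "g \<in> carrier G" for g
    by (rule G_eqI) (use that A c in \<open>simp_all add: act\<close>)
  then show ?thesis using A by (simp add: center_def)
qed

end

section \<open>Reduction modulo the ideal\<close>

context relative
begin

text \<open>\<open>cring\<close> admits the zero ring, so the improper ideal is treated together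
  with all others.\<close>

interpretation Q: orthogonal "R Quot I" n
  using quotient_is_cring[OF is_cring] by (simp add: orthogonal_def)

interpretation h: ring_hom_cring R "R Quot I" "(+>) I"
  by (rule rcos_ring_hom_cring[OF is_cring])

abbreviation red_mat where "red_mat \<equiv> map_mat (Omega n) ((+>) I)"
definition red_vec where "red_vec v = (\<lambda>i\<in>Omega n. I +> v i)"

lemma red_mat_apply [simp]: "i \<in> Omega n \<Longrightarrow> j \<in> Omega n \<Longrightarrow> red_mat A (i, j) = I +> A (i, j)"
  by (simp add: map_mat_def)

lemma red_vec_apply [simp]: "i \<in> Omega n \<Longrightarrow> red_vec v i = I +> v i"
  by (simp add: red_vec_def)

lemma red_mat_closed [simp]: "A \<in> mats \<Longrightarrow> red_mat A \<in> Q.mats"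
proof -
  assume "A \<in> mats"
  then have "I +> A (i, j) \<in> carrier (R Quot I)" if "i \<in> Omega n" "j \<in> Omega n" for i j using that by simp
  then show ?thesis unfolding Q.mats_def by (auto simp: map_mat_def)
qed

lemma red_vec_closed [simp]: "v \<in> vecs \<Longrightarrow> red_vec v \<in> Q.vecs"
proof -
  assume "v \<in> vecs"
  then have "I +> v i \<in> carrier (R Quot I)" if "i \<in> Omega n" for i using that by simp
  then show ?thesis unfolding Q.vecs_def by (auto simp: red_vec_def)
qed

lemma red_vec_surj: "w \<in> Q.vecs \<Longrightarrow> \<exists>v\<in>vecs. w = red_vec v"
proof -
  assume w: "w \<in> Q.vecs"
  have "\<exists>x. x \<in> carrier R \<and> w i = I +> x" if "i \<in> Omega n" for i
    using Q.vec_closed[OF w that] unfolding FactRing_def A_RCOSETS_def' by auto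
  then have "\<forall>i\<in>Omega n. \<exists>x. x \<in> carrier R \<and> w i = I +> x" by blast
  from bchoice[OF this] obtain f where f: "\<forall>i\<in>Omega n. f i \<in> carrier R \<and> w i = I +> f i" ..
  have v: "restrict f (Omega n) \<in> vecs" unfolding vecs_def using f by (intro restrict_PiE_iff[THEN iffD2]) blast
  moreover have "w = red_vec (restrict f (Omega n))"
  proof (rule Q.vec_eqI[OF w red_vec_closed[OF v]])
    fix i assume "i \<in> Omega n"
    then show "w i = red_vec (restrict f (Omega n)) i" using f by simp
  qed
  ultimately show ?thesis by blast
qed

lemma red_act: "A \<in> mats \<Longrightarrow> v \<in> vecs \<Longrightarrow> Q.act (red_mat A) (red_vec v) = red_vec (A \<bullet> v)"
proof (rule Q.vec_eqI)
  assume *: "A \<in> mats" "v \<in> vecs"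
  fix i assume i: "i \<in> Omega n"
  have "Q.act (red_mat A) (red_vec v) i = (\<Oplus>\<^bsub>R Quot I\<^esub>k\<in>Omega n. ((+>) I \<circ> (\<lambda>k. A (i, k) \<otimes> v k)) k)"
    unfolding Q.act_apply[OF i] using * i by (intro Q.finsum_cong') auto
  also have "\<dots> = I +> (\<Oplus>k\<in>Omega n. A (i, k) \<otimes> v k)"
    using * i by (subst h.hom_finsum) auto
  finally show "Q.act (red_mat A) (red_vec v) i = red_vec (A \<bullet> v) i" using i by (simp add: act_apply)
qed simp_all

lemma red_qf: "v \<in> vecs \<Longrightarrow> Q.qf (red_vec v) = I +> qf v"
proof -
  assume v: "v \<in> vecs"
  have "Q.qf (red_vec v) = (\<Oplus>\<^bsub>R Quot I\<^esub>k\<in>{1..int n}. ((+>) I \<circ> (\<lambda>k. v k \<otimes> v (- k))) k)"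
    unfolding Q.qf_eq[OF red_vec_closed[OF v]] using v by (intro Q.finsum_cong') (simp_all add: Pi_def)
  also have "\<dots> = I +> qf v"
    unfolding qf_eq[OF v] using v by (subst h.hom_finsum) (simp_all add: Pi_def)
  finally show ?thesis .
qed

lemma red_G: "A \<in> carrier G \<Longrightarrow> red_mat A \<in> carrier Q.G"
proof (rule Q.G_memI[where B = "red_mat (inv\<^bsub>G\<^esub> A)"])
  assume A: "A \<in> carrier G"
  then have iA: "inv\<^bsub>G\<^esub> A \<in> carrier G" by simp
  fix w assume "w \<in> Q.vecs"
  \<comment> \<open>Every column over the quotient lifts, so the isometry and inverse conditions can
    be checked on reductions of columns over R.\<close>
  then obtain v where v: "v \<in> vecs" and w: "w = red_vec v" using red_vec_surj by blast
  show "Q.act (red_mat A) (Q.act (red_mat (inv\<^bsub>G\<^esub> A)) w) = w"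
    "Q.act (red_mat (inv\<^bsub>G\<^esub> A)) (Q.act (red_mat A) w) = w"
    "Q.qf (Q.act (red_mat A) w) = Q.qf w"
    unfolding w using A iA v by (simp_all add: red_act red_qf)
qed simp_all

lemma red_eq_iff: "x \<in> carrier R \<Longrightarrow> y \<in> carrier R \<Longrightarrow> I +> x = I +> y \<longleftrightarrow> x \<ominus> y \<in> I"
  using quotient_eq_iff_same_a_r_cos[OF is_ideal] by blast

lemma red_zero_iff: "x \<in> carrier R \<Longrightarrow> I +> x = \<zero>\<^bsub>R Quot I\<^esub> \<longleftrightarrow> x \<in> I"
  using red_eq_iff[of x \<zero>] by (simp add: minus_eq)

text \<open>The centre over the quotient consists of the scalar isometries, by
  \<open>center_entries\<close> and \<open>scalar_center\<close>; lifting this to R leaves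
  congruences of entries.\<close>

lemma CO_iff:
  assumes A: "A \<in> carrier G"
  shows "A \<in> CO R n I \<longleftrightarrow> (\<forall>a\<in>Omega n. \<forall>b\<in>Omega n. (a \<noteq> b \<longrightarrow> A (a, b) \<in> I) \<and> A (a, a) \<ominus> A (b, b) \<in> I)"
proof
  assume "A \<in> CO R n I"
  then have c: "red_mat A \<in> center Q.G" by (simp add: CO_def)
  show "\<forall>a\<in>Omega n. \<forall>b\<in>Omega n. (a \<noteq> b \<longrightarrow> A (a, b) \<in> I) \<and> A (a, a) \<ominus> A (b, b) \<in> I"
  proof (intro ballI conjI impI)
    fix a b assume ab: "a \<in> Omega n" "b \<in> Omega n"
    show "A (a, b) \<in> I" if "a \<noteq> b"
      using Q.center_entries(1)[OF n3 c ab that] ab A by (simp add: red_zero_iff)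
    show "A (a, a) \<ominus> A (b, b) \<in> I"
      using Q.center_entries(2)[OF n3 c ab] ab A by (simp add: red_eq_iff)
  qed
next
  assume *: "\<forall>a\<in>Omega n. \<forall>b\<in>Omega n. (a \<noteq> b \<longrightarrow> A (a, b) \<in> I) \<and> A (a, a) \<ominus> A (b, b) \<in> I"
  have "red_mat A \<in> center Q.G"
  proof (rule Q.scalar_center[OF n3 red_G[OF A]])
    fix a b assume ab: "a \<in> Omega n" "b \<in> Omega n"
    show "red_mat A (a, b) = \<zero>\<^bsub>R Quot I\<^esub>" if "a \<noteq> b" using * that ab A by (simp add: red_zero_iff)
    show "red_mat A (a, a) = red_mat A (b, b)" using * ab A by (simp add: red_eq_iff)
  qed
  then show "A \<in> CO R n I" using A by (simp add: CO_def)
qed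

section \<open>Commutators of the full congruence subgroup with the elementary group\<close>

lemma finsum_I: "finite A \<Longrightarrow> (\<And>k. k \<in> A \<Longrightarrow> f k \<in> I) \<Longrightarrow> (\<Oplus>k\<in>A. f k) \<in> I"
proof (induction A rule: finite_induct)
  case (insert k A)
  then have "f \<in> insert k A \<rightarrow> carrier R" by auto
  then show ?case using insert by (simp add: Pi_def a_closed)
qed simp

lemma bil_I: "u \<in> vecs \<Longrightarrow> v \<in> vecs \<Longrightarrow> (\<And>k. k \<in> Omega n \<Longrightarrow> u k \<in> I) \<Longrightarrow> bil u v \<in> I"
  unfolding bil_def by (intro finsum_I) (auto intro: I_r_closed)

lemma minus_I: "x \<in> I \<Longrightarrow> y \<in> I \<Longrightarrow> x \<ominus> y \<in> I"
  by (simp add: minus_eq a_closed a_inv_closed)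

text \<open>Modulo \<open>I\<close>, 1 = <A e_i, A e_{-i}> reduces to the product of the diagonal
  entries at i and -i, and these two entries are congruent.\<close>

lemma CO_square:
  assumes A: "A \<in> CO R n I" and i: "i \<in> Omega n"
  shows "A (i, i) \<otimes> A (i, i) \<ominus> \<one> \<in> I"
proof -
  have AG: "A \<in> carrier G" using A by (simp add: CO_def)
  have e: "\<And>a b. a \<in> Omega n \<Longrightarrow> b \<in> Omega n \<Longrightarrow> (a \<noteq> b \<longrightarrow> A (a, b) \<in> I) \<and> A (a, a) \<ominus> A (b, b) \<in> I"
    using A CO_iff[OF AG] by blast
  let ?c = "A (i, i)" and ?d = "A (- i, - i)"
  have cd: "?c \<in> carrier R" "?d \<in> carrier R" using AG i by simp_all
  let ?u = "A \<bullet> ax i \<one>" and ?w = "A \<bullet> ax (- i) \<one>"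
  have uw: "?u \<in> vecs" "?w \<in> vecs" using AG by simp_all
  have u: "?u = ax i ?c \<oplus>\<^sub>v trunc (Omega n - {i}) ?u"
    by (rule vec_eqI) (use AG i in \<open>auto simp: act_ax\<close>)
  define r where "r = bil (trunc (Omega n - {i}) ?u) ?w"
  have r: "r \<in> I"
    unfolding r_def by (rule bil_I) (use AG i e in \<open>auto simp: act_ax\<close>)
  have "\<one> = bil ?u ?w" using AG i by simp
  also have "\<dots> = bil (ax i ?c) ?w \<oplus> r"
    by (subst u) (use uw cd in \<open>simp add: r_def del: bil_ax_left\<close>)
  also have "bil (ax i ?c) ?w = ?c \<otimes> ?d" using AG i by (simp add: act_ax)
  finally have 1: "?c \<otimes> ?d \<oplus> r = \<one>" by simp
  have "?c \<otimes> (?c \<ominus> ?d) \<ominus> r \<in> I" using e[of i "- i"] i cd by (intro minus_I[OF I_l_closed r]) auto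
  also have "?c \<otimes> (?c \<ominus> ?d) \<ominus> r = ?c \<otimes> ?c \<ominus> (?c \<otimes> ?d \<oplus> r)"
    using cd r by (simp add: minus_eq r_distr r_minus minus_add a_assoc)
  finally show ?thesis unfolding 1 .
qed

text \<open>The conjugate is E(u, xv) with u = A e_i and v = A e_j. Modulo EO(R, I) it is changed in
  three moves: v to a syzygy of u, then u to its part at i and -j, and finally a commutator to one
  elementary transvection, whose parameter differs by an element of \<open>I\<close>.\<close>

lemma CO_commutator_el:
  assumes A: "A \<in> CO R n I" and ij: "i \<in> Omega n" "j \<in> Omega n" "i \<noteq> j" "i \<noteq> - j" and x: "x \<in> carrier R"
  shows "A \<otimes>\<^bsub>G\<^esub> el i j x \<otimes>\<^bsub>G\<^esub> inv\<^bsub>G\<^esub> A \<otimes>\<^bsub>G\<^esub> inv\<^bsub>G\<^esub> (el i j x) \<in> N"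
proof -
  have AG [simp]: "A \<in> carrier G" using A by (simp add: CO_def)
  have e: "(a \<noteq> b \<longrightarrow> A (a, b) \<in> I) \<and> A (a, a) \<ominus> A (b, b) \<in> I" if "a \<in> Omega n" "b \<in> Omega n" for a b
    using A CO_iff[OF AG] that by blast
  have ij' [simp]: "- j \<noteq> i" "- i \<noteq> j" "j \<noteq> - i" "j \<noteq> i" using ij(3,4) by auto
  note ij [simp] x [simp]
  define c where "c = A (i, i)"
  have c [simp]: "c \<in> carrier R" by (simp add: c_def)
  define u v w where "u = A \<bullet> ax i \<one>" and "v = A \<bullet> ax j \<one>" and "w = A \<bullet> ax (- i) \<one>"
  have uvw [simp]: "u \<in> vecs" "v \<in> vecs" "w \<in> vecs" by (simp_all add: u_def v_def w_def)
  have ent: "u k = A (k, i)" "v k = A (k, j)" if "k \<in> Omega n" for k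
    using that by (simp_all add: u_def v_def act_ax)
  have q [simp]: "qf u = \<zero>" "bil u v = \<zero>" "bil u w = \<one>"
    by (simp_all add: u_def v_def w_def)
  have ui: "u i = c" by (simp add: ent c_def)
  \<comment> \<open>Modulo \<open>I\<close> v is c e_j, which need not be orthogonal to u. This
    syzygy is, and differs from c e_j only by an entry of \<open>I\<close> at -i; hence E(u, x(v -
    s)) is covered by \<open>eich_N\<close>.\<close>
  define s where "s = syz u j (- i)"
  have s [simp]: "s \<in> vecs" "bil u s = \<zero>" by (simp_all add: s_def)
  define d where "d = \<ominus> u (- j)"
  have d: "d \<in> I" using e[of "- j" i] by (simp add: d_def ent)
  have s_eq: "s = ax j c \<oplus>\<^sub>v ax (- i) d" by (simp add: s_def syz_def ui d_def)
  define \<beta> where "\<beta> = x \<odot>\<^sub>v (v \<oplus>\<^sub>v (\<ominus> \<one>) \<odot>\<^sub>v s)"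
  have \<beta> [simp]: "\<beta> \<in> vecs" "bil u \<beta> = \<zero>" by (simp_all add: \<beta>_def)
  have \<beta>I: "\<beta> k \<in> I" if k: "k \<in> Omega n" for k
  proof -
    have "v k \<ominus> s k \<in> I"
    proof (cases "k = j")
      case True
      then show ?thesis using e[of j i] by (simp add: s_eq ent c_def d)
    next
      case False
      then show ?thesis using e[of k j] k d by (intro minus_I) (auto simp: s_eq ent)
    qed
    then have "x \<otimes> (v k \<ominus> s k) \<in> I" by (intro I_l_closed) simp_all
    then show ?thesis using k by (simp add: \<beta>_def minus_eq l_minus)
  qed
  have \<beta>N: "eich u \<beta> \<in> N"
    by (rule eich_N[OF _ _ _ _ _ _ \<beta>I, where w = w]) simp_all
  have "x \<odot>\<^sub>v v = \<beta> \<oplus>\<^sub>v x \<odot>\<^sub>v s"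
    by (rule vec_eqI) (simp_all add: \<beta>_def l_minus r_minus r_distr a_assoc l_neg)
  then have 1: "A \<otimes>\<^bsub>G\<^esub> el i j x \<otimes>\<^bsub>G\<^esub> inv\<^bsub>G\<^esub> A = eich u \<beta> \<otimes>\<^bsub>G\<^esub> eich u (x \<odot>\<^sub>v s)"
    using act_smul[of A x "ax j \<one>"] eich_conj[of A "ax i \<one>" "ax j x"]
    by (simp add: el_def u_def[symmetric] v_def[symmetric] eich_add)
  define z where "z = ax j (x \<otimes> c) \<oplus>\<^sub>v ax (- i) (x \<otimes> d)"
  have dR [simp]: "d \<in> carrier R" using d by simp
  have z [simp]: "z \<in> vecs" "qf z = \<zero>" by (simp_all add: z_def)
  have zs: "x \<odot>\<^sub>v s = z" by (simp add: s_eq z_def smul_vadd)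
  have uz: "bil u z = \<zero>" by (simp flip: zs)
  define y where "y = (\<ominus> \<one>) \<odot>\<^sub>v u"
  have y [simp]: "y \<in> vecs" by (simp add: y_def)
  have zy: "bil z y = \<zero>" using uz bil_sym[of z u] by (simp add: y_def)
  have 2: "eich u z = eich z y" unfolding y_def using uz by (intro eich_swap) simp_all
  define b where "b = y (- j)"
  have yI: "y k \<in> I" if "k \<in> Omega n" "k \<noteq> i" for k
    using e[of k i] that by (simp add: y_def ent l_minus a_inv_closed)
  have bI: "b \<in> I" unfolding b_def by (rule yI) auto
  have bR [simp]: "b \<in> carrier R" using bI by simp
  \<comment> \<open>y0 vanishes opposite to the plane of z and has entries in \<open>I\<close>, so
    it contributes an element of EO(R, I); y1 keeps the entry -c outside \<open>I\<close>.\<close>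
  define y0 y1 where "y0 = trunc (Omega n - {- j, i}) y" and "y1 = ax i (\<ominus> c) \<oplus>\<^sub>v ax (- j) b"
  have y01 [simp]: "y0 \<in> vecs" "y1 \<in> vecs" "qf y1 = \<zero>" by (auto simp: y0_def y1_def)
  have y_eq: "y = y0 \<oplus>\<^sub>v y1"
    by (rule vec_eqI) (auto simp: y0_def y1_def b_def y_def ui l_minus)
  have zy0: "bil z y0 = \<zero>" by (auto simp: z_def y0_def)
  have zy1: "bil z y1 = \<zero>" using zy zy0 unfolding y_eq by simp
  have y0N: "eich z y0 \<in> N"
    unfolding z_def
  proof (rule eich_plane_in[OF N_subgroup is_ideal el_N])
    fix k assume k: "k \<in> Omega n"
    have "y0 k \<in> I" using yI[OF k] k by (auto simp: y0_def)
    then show "x \<otimes> c \<otimes> y0 k \<in> I" "x \<otimes> d \<otimes> y0 k \<in> I" by (auto intro: I_l_closed)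
  qed (auto simp: y0_def)
  have 3: "eich z y = eich z y0 \<otimes>\<^bsub>G\<^esub> eich z y1"
    unfolding y_eq using zy0 zy1 by (intro eich_add) simp_all
  obtain m where m: "m \<in> Omega n" "m \<noteq> i" "m \<noteq> - i" "m \<noteq> j" "m \<noteq> - j"
    using third_index[OF n3] by blast
  have mm: "- m \<noteq> i" "- m \<noteq> j" "i \<noteq> - m" "j \<noteq> - m" "i \<noteq> m" "j \<noteq> m" using m by auto
  note m [simp]
  note mm [simp]
  let ?e = "ax m \<one>" and ?f = "ax (- m) \<one>"
  let ?z = "ax j (x \<otimes> c)" and ?y = "ax i (\<ominus> c)"
  have ze: "eich z ?e = el j m (x \<otimes> c) \<otimes>\<^bsub>G\<^esub> el (- i) m (x \<otimes> d)"
    unfolding z_def by (subst eich_add_left) (auto simp: eich_ax)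
  have fy: "eich ?f y1 = el (- m) i (\<ominus> c) \<otimes>\<^bsub>G\<^esub> el (- m) (- j) b"
    unfolding y1_def by (subst eich_add) (auto simp: el_def)
  have 4: "eich z y1 = eich z ?e \<otimes>\<^bsub>G\<^esub> eich ?f y1 \<otimes>\<^bsub>G\<^esub> inv\<^bsub>G\<^esub> (eich z ?e) \<otimes>\<^bsub>G\<^esub> inv\<^bsub>G\<^esub> (eich ?f y1)"
    by (rule eich_commutator) (use zy1 in \<open>auto simp: z_def y1_def\<close>)
  have 5: "el j i (x \<otimes> c \<otimes> \<ominus> c) = el j m (x \<otimes> c) \<otimes>\<^bsub>G\<^esub> el (- m) i (\<ominus> c) \<otimes>\<^bsub>G\<^esub> inv\<^bsub>G\<^esub> (el j m (x \<otimes> c)) \<otimes>\<^bsub>G\<^esub> inv\<^bsub>G\<^esub> (el (- m) i (\<ominus> c))"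
    using eich_commutator[of ?z ?y m] by (auto simp: eich_ax)
  \<comment> \<open>Both commutator entries are single transvections up to factors with parameters
    xd and b in \<open>I\<close>, so the commutator agrees with the elementary one modulo EO(R,
    I).\<close>
  have 6: "eich z y1 \<otimes>\<^bsub>G\<^esub> inv\<^bsub>G\<^esub> (el j i (x \<otimes> c \<otimes> \<ominus> c)) \<in> N"
    unfolding 4 5 ze fy
    by (rule G.commutator_cong[OF EO_subgroup N_subgroup N_sub_EO N_conj])
      (use d bI in \<open>auto intro!: el_N intro: I_l_closed\<close>)
  have inv_el: "inv\<^bsub>G\<^esub> (el j i t) = el j i (\<ominus> t)" if "t \<in> carrier R" for t
    using that eich_inv[of "ax j \<one>" "ax i t"] by (auto simp: el_def l_minus)
  have "el i j x = el j i (\<ominus> x)"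
    using eich_swap[of "ax i \<one>" "ax j x"] by (auto simp: eich_ax[of x] el_def[symmetric] eich_ax r_minus)
  then have "el j i (x \<otimes> c \<otimes> \<ominus> c) \<otimes>\<^bsub>G\<^esub> inv\<^bsub>G\<^esub> (el i j x) = el j i (x \<otimes> c \<otimes> \<ominus> c) \<otimes>\<^bsub>G\<^esub> el j i x"
    by (simp add: inv_el)
  also have "\<dots> = el j i (x \<otimes> c \<otimes> \<ominus> c \<oplus> x)"
  proof -
    have "ax i (x \<otimes> c \<otimes> \<ominus> c \<oplus> x) = ax i (x \<otimes> c \<otimes> \<ominus> c) \<oplus>\<^sub>v ax i x" by (rule vec_eqI) auto
    then show ?thesis unfolding el_def by (simp add: eich_add)
  qed
  \<comment> \<open>The two parameters differ by x(1 - c^2), which is in \<open>I\<close> since the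
    scalar squares to 1 modulo \<open>I\<close>.\<close>
  also have "\<dots> \<in> N"
  proof (rule el_N)
    have "x \<otimes> \<ominus> (c \<otimes> c \<ominus> \<one>) \<in> I"
      using CO_square[OF A ij(1)] by (intro I_l_closed a_inv_closed) (simp_all add: c_def)
    also have "x \<otimes> \<ominus> (c \<otimes> c \<ominus> \<one>) = x \<otimes> c \<otimes> \<ominus> c \<oplus> x"
      by (simp add: minus_eq minus_add r_distr r_minus m_assoc)
    finally show "x \<otimes> c \<otimes> \<ominus> c \<oplus> x \<in> I" .
  qed auto
  finally have 7: "el j i (x \<otimes> c \<otimes> \<ominus> c) \<otimes>\<^bsub>G\<^esub> inv\<^bsub>G\<^esub> (el i j x) \<in> N" .
  have gs: "eich u \<beta> \<in> carrier G" "eich z y0 \<in> carrier G" "eich z y1 \<in> carrier G" "el j i (x \<otimes> c \<otimes> \<ominus> c) \<in> carrier G" "el i j x \<in> carrier G"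
    using zy0 zy1 by (simp_all add: el_closed)
  have "A \<otimes>\<^bsub>G\<^esub> el i j x \<otimes>\<^bsub>G\<^esub> inv\<^bsub>G\<^esub> A \<otimes>\<^bsub>G\<^esub> inv\<^bsub>G\<^esub> (el i j x) =
    eich u \<beta> \<otimes>\<^bsub>G\<^esub> (eich z y0 \<otimes>\<^bsub>G\<^esub> ((eich z y1 \<otimes>\<^bsub>G\<^esub> inv\<^bsub>G\<^esub> (el j i (x \<otimes> c \<otimes> \<ominus> c))) \<otimes>\<^bsub>G\<^esub> (el j i (x \<otimes> c \<otimes> \<ominus> c) \<otimes>\<^bsub>G\<^esub> inv\<^bsub>G\<^esub> (el i j x))))"
    unfolding 1 zs 2 3 using gs by (simp add: G.m_assoc G.inv_cancel)
  also have "\<dots> \<in> N" by (intro subgroup.m_closed[OF N_subgroup] \<beta>N y0N 6 7)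
  finally show ?thesis .
qed

text \<open>From [A, gh] = [A, g] g[A, h]g^-1 and the analogous formula for inverses, the elements
  of EO(R) whose commutator with A is in EO(R, I) form a subgroup; it contains the
  generators.\<close>

lemma CO_commutator:
  assumes A: "A \<in> CO R n I" and g: "g \<in> EO R n"
  shows "A \<otimes>\<^bsub>G\<^esub> g \<otimes>\<^bsub>G\<^esub> inv\<^bsub>G\<^esub> A \<otimes>\<^bsub>G\<^esub> inv\<^bsub>G\<^esub> g \<in> N"
proof -
  have AG [simp]: "A \<in> carrier G" using A by (simp add: CO_def)
  have c [simp]: "x \<in> carrier G" if "x \<in> EO R n" for x using subgroup.mem_carrier[OF EO_subgroup that] .
  let ?c = "\<lambda>g. A \<otimes>\<^bsub>G\<^esub> g \<otimes>\<^bsub>G\<^esub> inv\<^bsub>G\<^esub> A \<otimes>\<^bsub>G\<^esub> inv\<^bsub>G\<^esub> g"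
  let ?K = "{g \<in> EO R n. ?c g \<in> N}"
  have "subgroup ?K G"
  proof (rule G.subgroupI)
    have "\<one>\<^bsub>G\<^esub> \<in> ?K" using subgroup.one_closed[OF EO_subgroup] subgroup.one_closed[OF N_subgroup] by simp
    then show "?K \<noteq> {}" by blast
  next
    fix g assume g: "g \<in> ?K"
    have "inv\<^bsub>G\<^esub> g \<otimes>\<^bsub>G\<^esub> inv\<^bsub>G\<^esub> (?c g) \<otimes>\<^bsub>G\<^esub> inv\<^bsub>G\<^esub> (inv\<^bsub>G\<^esub> g) \<in> N"
      using g by (intro N_conj subgroup.m_inv_closed[OF N_subgroup] subgroup.m_inv_closed[OF EO_subgroup]) auto
    also have "inv\<^bsub>G\<^esub> g \<otimes>\<^bsub>G\<^esub> inv\<^bsub>G\<^esub> (?c g) \<otimes>\<^bsub>G\<^esub> inv\<^bsub>G\<^esub> (inv\<^bsub>G\<^esub> g) = ?c (inv\<^bsub>G\<^esub> g)"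
      using g by (simp add: G.m_assoc G.inv_mult_group G.inv_cancel)
    finally show "inv\<^bsub>G\<^esub> g \<in> ?K" using g subgroup.m_inv_closed[OF EO_subgroup] by simp
  next
    fix g h assume g: "g \<in> ?K" and h: "h \<in> ?K"
    have "?c g \<otimes>\<^bsub>G\<^esub> (g \<otimes>\<^bsub>G\<^esub> ?c h \<otimes>\<^bsub>G\<^esub> inv\<^bsub>G\<^esub> g) \<in> N"
      using g h by (intro subgroup.m_closed[OF N_subgroup _ N_conj]) auto
    also have "?c g \<otimes>\<^bsub>G\<^esub> (g \<otimes>\<^bsub>G\<^esub> ?c h \<otimes>\<^bsub>G\<^esub> inv\<^bsub>G\<^esub> g) = ?c (g \<otimes>\<^bsub>G\<^esub> h)"
      using g h by (simp add: G.m_assoc G.inv_mult_group G.inv_cancel)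
    finally show "g \<otimes>\<^bsub>G\<^esub> h \<in> ?K" using g h subgroup.m_closed[OF EO_subgroup] by simp
  qed auto
  then have "EO_ideal R n (carrier R) \<subseteq> ?K"
    using CO_commutator_el[OF A] by (intro EO_ideal_subset) auto
  then show ?thesis using g by (auto simp: EO_def)
qed

text \<open>Here ghg^-1 = [h, g]^-1 h, and the commutator lies in EO(R, I), hence in
  \<open>H\<close>.\<close>

lemma sandwich_normalized:
  assumes H: "subgroup H G" and NH: "N \<subseteq> H" and HC: "H \<subseteq> CO R n I" and g: "g \<in> EO R n" and h: "h \<in> H"
  shows "g \<otimes>\<^bsub>G\<^esub> h \<otimes>\<^bsub>G\<^esub> inv\<^bsub>G\<^esub> g \<in> H"
proof -
  have [simp]: "h \<in> carrier G" "g \<in> carrier G"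
    using subgroup.mem_carrier[OF H h] subgroup.mem_carrier[OF EO_subgroup g] .
  let ?c = "h \<otimes>\<^bsub>G\<^esub> g \<otimes>\<^bsub>G\<^esub> inv\<^bsub>G\<^esub> h \<otimes>\<^bsub>G\<^esub> inv\<^bsub>G\<^esub> g"
  have "?c \<in> H" using CO_commutator[of h g] NH HC g h by blast
  then have "inv\<^bsub>G\<^esub> ?c \<otimes>\<^bsub>G\<^esub> h \<in> H"
    by (intro subgroup.m_closed[OF H subgroup.m_inv_closed[OF H] h])
  also have "inv\<^bsub>G\<^esub> ?c \<otimes>\<^bsub>G\<^esub> h = g \<otimes>\<^bsub>G\<^esub> h \<otimes>\<^bsub>G\<^esub> inv\<^bsub>G\<^esub> g"
    by (simp add: G.m_assoc G.inv_mult_group G.inv_cancel)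
  finally show ?thesis .
qed

end

subsection \<open>The level of a normalized subgroup\<close>

context orthogonal
begin

lemma el_add:
  assumes "i \<in> Omega n" "j \<in> Omega n" "i \<noteq> - j" "x \<in> carrier R" "y \<in> carrier R"
  shows "el i j (x \<oplus> y) = el i j x \<otimes>\<^bsub>G\<^esub> el i j y"
proof -
  have "ax j (x \<oplus> y) = ax j x \<oplus>\<^sub>v ax j y" using assms by (intro vec_eqI) auto
  then show ?thesis unfolding el_def using assms by (auto intro!: eich_add)
qed

lemma el_zero: "el i j \<zero> = \<one>\<^bsub>G\<^esub>"
proof -
  have "ax j \<zero> = \<zero> \<odot>\<^sub>v ax i \<one>" by (rule vec_eqI) auto
  then show ?thesis unfolding el_def using eich_self[of \<zero> "ax i \<one>"] by simp
qed

lemma el_inv: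
  assumes "i \<in> Omega n" "j \<in> Omega n" "i \<noteq> - j" "x \<in> carrier R"
  shows "inv\<^bsub>G\<^esub> (el i j x) = el i j (\<ominus> x)"
  using assms eich_inv[of "ax i \<one>" "ax j x"] by (auto simp: el_def l_minus)

lemma el_swap:
  assumes "i \<in> Omega n" "j \<in> Omega n" "i \<noteq> - j" "x \<in> carrier R"
  shows "el i j x = el j i (\<ominus> x)"
  using assms eich_swap[of "ax i \<one>" "ax j x"] eich_ax[of x "\<ominus> \<one>" j i] by (auto simp: el_def r_minus)

lemma act_el:
  assumes "i \<in> Omega n" "j \<in> Omega n" "x \<in> carrier R" "w \<in> vecs"
  shows "el i j x \<bullet> w = w \<oplus>\<^sub>v ax i (x \<otimes> w (- j)) \<oplus>\<^sub>v ax j (\<ominus> (w (- i) \<otimes> x))"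
  unfolding el_def by (rule vec_eqI) (use assms in \<open>simp_all add: act_eich minus_eq l_minus\<close>)

end

section \<open>Spreading transvections inside a normalized subgroup, and its level ideal\<close>

locale normalized = orthogonal R n for R (structure) and n +
  fixes H
  assumes n3: "3 \<le> n" and H_subgroup: "subgroup H G"
    and H_conj: "\<And>g h. g \<in> EO R n \<Longrightarrow> h \<in> H \<Longrightarrow> g \<otimes>\<^bsub>G\<^esub> h \<otimes>\<^bsub>G\<^esub> inv\<^bsub>G\<^esub> g \<in> H"
begin

text \<open>Demanding all index pairs frees the definition from a choice of pair; by
  \<open>level_memI\<close> a single pair already suffices.\<close>

definition level where
  "level = {x \<in> carrier R. \<forall>i\<in>Omega n. \<forall>j\<in>Omega n. i \<noteq> j \<longrightarrow> i \<noteq> - j \<longrightarrow> el i j x \<in> H}"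

lemma level_el:
  "i \<in> Omega n \<Longrightarrow> j \<in> Omega n \<Longrightarrow> i \<noteq> j \<Longrightarrow> i \<noteq> - j \<Longrightarrow> x \<in> level \<Longrightarrow> el i j x \<in> H"
  by (simp add: level_def)

lemma H_carrier: "h \<in> H \<Longrightarrow> h \<in> carrier G"
  by (rule subgroup.mem_carrier[OF H_subgroup])

lemma EO_carrier: "g \<in> EO R n \<Longrightarrow> g \<in> carrier G"
  by (rule subgroup.mem_carrier[OF EO_subgroup])

lemma H_commutator:
  assumes "g \<in> EO R n" "h \<in> H"
  shows "h \<otimes>\<^bsub>G\<^esub> g \<otimes>\<^bsub>G\<^esub> inv\<^bsub>G\<^esub> h \<otimes>\<^bsub>G\<^esub> inv\<^bsub>G\<^esub> g \<in> H"
proof -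
  have "h \<otimes>\<^bsub>G\<^esub> (g \<otimes>\<^bsub>G\<^esub> inv\<^bsub>G\<^esub> h \<otimes>\<^bsub>G\<^esub> inv\<^bsub>G\<^esub> g) \<in> H"
    using assms by (intro subgroup.m_closed[OF H_subgroup _ H_conj] subgroup.m_inv_closed[OF H_subgroup])
  then show ?thesis using assms H_carrier EO_carrier by (simp add: G.m_assoc)
qed

text \<open>Conjugation by el (-j) k (-r) fixes e_i and sends x e_j to x e_j + xr e_k, so it
  multiplies the given transvection by the desired one.\<close>

lemma el_step:
  assumes h: "el i j x \<in> H" and ijk: "i \<in> Omega n" "j \<in> Omega n" "k \<in> Omega n" "i \<noteq> j" "i \<noteq> - j"
    "k \<noteq> i" "k \<noteq> - i" "k \<noteq> j" "k \<noteq> - j" and xr: "x \<in> carrier R" "r \<in> carrier R"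
  shows "el i k (x \<otimes> r) \<in> H"
proof -
  have d: "- j \<noteq> k" "i \<noteq> - k" "- i \<noteq> k" "j \<noteq> - k" "j \<noteq> i" "- j \<noteq> i" "- i \<noteq> j"
    "i \<noteq> 0" "j \<noteq> 0" "k \<noteq> 0" "j \<noteq> k" "- k \<noteq> i" "- k \<noteq> j" using ijk Omega_nonzero by auto
  note ijk [simp] xr [simp] d [simp]
  let ?g = "el (- j) k (\<ominus> r)"
  have g: "?g \<in> EO R n" by (rule el_EO) simp_all
  have gi: "?g \<bullet> ax i \<one> = ax i \<one>" and gj: "?g \<bullet> ax j x = ax j x \<oplus>\<^sub>v ax k (x \<otimes> r)"
    by (rule vec_eqI; simp add: act_el r_minus)+
  have "?g \<otimes>\<^bsub>G\<^esub> el i j x \<otimes>\<^bsub>G\<^esub> inv\<^bsub>G\<^esub> ?g = el i j x \<otimes>\<^bsub>G\<^esub> el i k (x \<otimes> r)"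
    using eich_conj[of ?g "ax i \<one>" "ax j x"] by (simp add: gi gj el_def[of i] eich_add)
  then have "inv\<^bsub>G\<^esub> (el i j x) \<otimes>\<^bsub>G\<^esub> (el i j x \<otimes>\<^bsub>G\<^esub> el i k (x \<otimes> r)) \<in> H"
    using H_conj[OF g h] h by (simp add: subgroup.m_closed[OF H_subgroup] subgroup.m_inv_closed[OF H_subgroup])
  then show ?thesis by (simp add: G.inv_cancel)
qed

text \<open>The excluded targets k = j and k = -j are reached by a detour through a third
  index.\<close>

lemma el_step':
  assumes h: "el i j x \<in> H" and ijk: "i \<in> Omega n" "j \<in> Omega n" "k \<in> Omega n" "i \<noteq> j" "i \<noteq> - j"
    "k \<noteq> i" "k \<noteq> - i" and xr: "x \<in> carrier R" "r \<in> carrier R"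
  shows "el i k (x \<otimes> r) \<in> H"
proof (cases "k = j \<or> k = - j")
  case True
  obtain m where m: "m \<in> Omega n" "m \<noteq> i" "m \<noteq> - i" "m \<noteq> j" "m \<noteq> - j"
    using third_index[OF n3] by blast
  have "el i m (x \<otimes> \<one>) \<in> H" by (rule el_step[OF h]) (use m ijk xr in auto)
  then show ?thesis using el_step[of i m x k r] m ijk xr True by auto
qed (use el_step[OF h] ijk xr in auto)

lemma el_swap_H:
  assumes h: "el i j x \<in> H" and ij: "i \<in> Omega n" "j \<in> Omega n" "i \<noteq> - j" "x \<in> carrier R"
  shows "el j i x \<in> H"
proof -
  have ji: "j \<noteq> - i" using ij(3) by auto
  have "inv\<^bsub>G\<^esub> (el i j x) = el j i x" using ij ji el_swap[of i j x] el_inv[of j i "\<ominus> x"] by simp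
  then show ?thesis using subgroup.m_inv_closed[OF H_subgroup h] by simp
qed

lemma el_spread:
  assumes h: "el i j x \<in> H" and ij: "i \<in> Omega n" "j \<in> Omega n" "i \<noteq> j" "i \<noteq> - j"
    and kl: "k \<in> Omega n" "l \<in> Omega n" "k \<noteq> l" "k \<noteq> - l" and xr: "x \<in> carrier R" "r \<in> carrier R"
  shows "el k l (x \<otimes> r) \<in> H"
proof -
  have step: "el i k x \<in> H" if "el i j x \<in> H" "i \<in> Omega n" "j \<in> Omega n" "k \<in> Omega n" "i \<noteq> j" "i \<noteq> - j" "k \<noteq> i" "k \<noteq> - i" for i j k
    using el_step'[of i j x k \<one>] that xr by simp
  have "\<exists>m\<in>Omega n. m \<noteq> k \<and> m \<noteq> - k \<and> el k m x \<in> H"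
  proof (cases "k = i \<or> k = - i")
    case False
    then have ik: "el i k x \<in> H" using step[OF h ij(1,2) kl(1) ij(3,4)] by auto
    have "el k i x \<in> H" by (rule el_swap_H[OF ik]) (use False ij kl xr in auto)
    then show ?thesis using False ij by auto
  next
    case True
    obtain m where m: "m \<in> Omega n" "m \<noteq> i" "m \<noteq> - i" using third_index[OF n3] by blast
    have mk: "m \<noteq> k" "m \<noteq> - k" "k \<noteq> - m" "i \<noteq> - m" "k \<noteq> m" using m True by auto
    have im: "el i m x \<in> H" using step[OF h ij(1,2) m(1) ij(3,4) m(2,3)] .
    have mi: "el m i x \<in> H" by (rule el_swap_H[OF im]) (use m mk ij xr in auto)
    have mk': "el m k x \<in> H" by (rule step[OF mi]) (use m mk ij kl in auto)
    have "el k m x \<in> H" by (rule el_swap_H[OF mk']) (use m mk kl xr in auto)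
    then show ?thesis using m mk by blast
  qed
  then obtain m where m: "m \<in> Omega n" "m \<noteq> k" "m \<noteq> - k" "el k m x \<in> H" by blast
  then show ?thesis using el_step'[OF m(4) kl(1) m(1) kl(2) _ _ _ _ xr] kl by auto
qed

lemma level_memI:
  assumes "el i j x \<in> H" "i \<in> Omega n" "j \<in> Omega n" "i \<noteq> j" "i \<noteq> - j" "x \<in> carrier R"
  shows "x \<in> level"
  using el_spread[OF assms(1-5) _ _ _ _ assms(6), of _ _ \<one>] assms(6) by (simp add: level_def)

lemma level_ideal: "ideal level R"
proof (rule idealI)
  have 12: "(1::int) \<in> Omega n" "(2::int) \<in> Omega n" using n3 by (auto simp: Omega_def)
  have mult: "a \<otimes> r \<in> level" if "a \<in> level" "r \<in> carrier R" for a r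
  proof -
    have a: "a \<in> carrier R" "el 1 2 a \<in> H" using that 12 by (auto simp: level_def)
    have "el 1 2 (a \<otimes> r) \<in> H" by (rule el_spread[OF a(2)]) (use 12 a that in auto)
    then show ?thesis by (rule level_memI) (use 12 a that in auto)
  qed
  then show "a \<otimes> r \<in> level" if "a \<in> level" "r \<in> carrier R" for a r using that .
  show "r \<otimes> a \<in> level" if "a \<in> level" "r \<in> carrier R" for a r
    using mult[OF that] that by (simp add: m_comm level_def)
  show "subgroup level (add_monoid R)"
  proof (rule add.subgroupI)
    have "\<zero> \<in> level" using subgroup.one_closed[OF H_subgroup] by (simp add: level_def el_zero)
    then show "level \<noteq> {}" by blast
    show "\<ominus> a \<in> level" if "a \<in> level" for a
      using mult[OF that, of "\<ominus> \<one>"] that by (simp add: level_def r_minus)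
    show "a \<oplus> b \<in> level" if "a \<in> level" "b \<in> level" for a b
      using that by (auto simp: level_def el_add intro: subgroup.m_closed[OF H_subgroup])
  qed (auto simp: level_def)
qed (rule ring_axioms)

lemma entry_in_level:
  assumes \<sigma>: "\<sigma> \<in> H" and ij: "i \<in> Omega n" "j \<in> Omega n" "i \<noteq> j" "i \<noteq> - j"
  shows "\<sigma> (i, j) \<in> level"
proof -
  have \<sigma>G [simp]: "\<sigma> \<in> carrier G" using \<sigma> by (rule H_carrier)
  obtain l where l: "l \<in> Omega n" "l \<noteq> i" "l \<noteq> - i" "l \<noteq> j" "l \<noteq> - j"
    using third_index[OF n3] by blast
  have d: "j \<noteq> i" "j \<noteq> - i" "- i \<noteq> j" "- j \<noteq> i" "i \<noteq> l" "i \<noteq> - l" "- i \<noteq> l" "- l \<noteq> i"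
    "j \<noteq> l" "j \<noteq> - l" "- j \<noteq> l" "- l \<noteq> j" "i \<noteq> 0" "j \<noteq> 0" "l \<noteq> 0" using ij l Omega_nonzero by auto
  note ij [simp] l [simp] d [simp]
  let ?e = "\<lambda>k. ax k \<one>"
  define u where "u = \<sigma> \<bullet> ?e j"
  have u [simp]: "u \<in> vecs" by (simp add: u_def)
  define c where "c = u i"
  have c [simp]: "c \<in> carrier R" by (simp add: c_def)
  have c_eq: "c = \<sigma> (i, j)" by (simp add: c_def u_def act_ax)
  text \<open>On the totally isotropic span of \<open>e\<^bsub>-i\<^esub>, e\<^bsub>-j\<^esub>, e\<^bsub>l\<^esub>\<close> the coordinates of \<open>u\<close> determine
    a bivector whose contraction with \<open>u\<close> vanishes; \<open>\<tau>\<close> is the corresponding unipotent element.\<close>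
  define \<tau> where "\<tau> = el (- i) (- j) (\<ominus> u (- l)) \<otimes>\<^bsub>G\<^esub> el (- i) l (u j) \<otimes>\<^bsub>G\<^esub> el l (- j) c"
  have \<tau>E: "\<tau> \<in> EO R n"
    unfolding \<tau>_def by (intro subgroup.m_closed[OF EO_subgroup] el_EO) simp_all
  have \<tau>G [simp]: "\<tau> \<in> carrier G" using \<tau>E by (rule EO_carrier)
  have \<tau>u: "\<tau> \<bullet> u = u"
  proof (rule vec_eqI)
    fix k assume k: "k \<in> Omega n"
    have m: "u (- l) \<otimes> u i = u i \<otimes> u (- l)" "u (- l) \<otimes> u j = u j \<otimes> u (- l)"
      by (intro m_comm; simp)+
    show "(\<tau> \<bullet> u) k = u k"
      using k by (auto simp: \<tau>_def act_el c_def l_minus r_minus a_assoc l_neg r_neg m)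
  qed simp_all
  \<comment> \<open>The displacement of e_j under \<tau>; its entry at l is the coordinate to be
    extracted.\<close>
  define y where "y = ax l c \<oplus>\<^sub>v ax (- i) (\<ominus> u (- l))"
  have y [simp]: "y \<in> vecs" by (simp add: y_def)
  have \<tau>j: "\<tau> \<bullet> ?e j = ?e j \<oplus>\<^sub>v y"
    by (rule vec_eqI) (simp_all add: \<tau>_def act_el y_def)
  have \<tau>i: "\<tau> \<bullet> ?e (- i) = ?e (- i)"
    by (rule vec_eqI) (simp_all add: \<tau>_def act_el)
  define \<rho> where "\<rho> = inv\<^bsub>G\<^esub> \<sigma> \<otimes>\<^bsub>G\<^esub> \<tau> \<otimes>\<^bsub>G\<^esub> \<sigma>"
  have \<rho>G [simp]: "\<rho> \<in> carrier G" by (simp add: \<rho>_def)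
  have \<rho>j: "\<rho> \<bullet> ?e j = ?e j"
    using \<tau>u by (simp add: \<rho>_def u_def)
  define v where "v = \<rho> \<bullet> ?e (- i)"
  have v [simp]: "v \<in> vecs" by (simp add: v_def)
  \<comment> \<open>\<rho> fixes e_j, so v remains orthogonal to e_j, as e_{-i} was.\<close>
  have jv: "bil (?e j) v = \<zero>"
    using bil_act[of \<rho> "?e j" "?e (- i)"] unfolding \<rho>j v_def[symmetric] by simp
  then have vj: "v (- j) = \<zero>" by simp
  let ?g = "el j (- i) \<one>"
  have g: "?g \<in> EO R n" by (rule el_EO) simp_all
  define h where "h = inv\<^bsub>G\<^esub> \<tau> \<otimes>\<^bsub>G\<^esub> \<rho>"
  have "inv\<^bsub>G\<^esub> \<tau> \<otimes>\<^bsub>G\<^esub> inv\<^bsub>G\<^esub> \<sigma> \<otimes>\<^bsub>G\<^esub> inv\<^bsub>G\<^esub> (inv\<^bsub>G\<^esub> \<tau>) \<otimes>\<^bsub>G\<^esub> \<sigma> \<in> H"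
    by (rule subgroup.m_closed[OF H_subgroup H_conj[OF subgroup.m_inv_closed[OF EO_subgroup \<tau>E] subgroup.m_inv_closed[OF H_subgroup \<sigma>]] \<sigma>])
  then have h: "h \<in> H" by (simp add: h_def \<rho>_def G.m_assoc)
  \<comment> \<open>The first commutator, of h with g, conjugated by \<tau>. Since \<tau>h = \<rho>,
    it compares the conjugates of g by \<rho>, which keeps e_j, and by \<tau>, which does
    not.\<close>
  define x where "x = eich (?e j) v \<otimes>\<^bsub>G\<^esub> inv\<^bsub>G\<^esub> (eich (?e j \<oplus>\<^sub>v y) (?e (- i)))"
  have \<rho>g: "\<rho> \<otimes>\<^bsub>G\<^esub> ?g \<otimes>\<^bsub>G\<^esub> inv\<^bsub>G\<^esub> \<rho> = eich (?e j) v"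
    using eich_conj[of \<rho> "?e j" "?e (- i)"] by (simp add: el_def \<rho>j v_def)
  have \<tau>g: "\<tau> \<otimes>\<^bsub>G\<^esub> ?g \<otimes>\<^bsub>G\<^esub> inv\<^bsub>G\<^esub> \<tau> = eich (?e j \<oplus>\<^sub>v y) (?e (- i))"
    using eich_conj[of \<tau> "?e j" "?e (- i)"] by (simp add: el_def \<tau>j \<tau>i)
  have "\<tau> \<otimes>\<^bsub>G\<^esub> (h \<otimes>\<^bsub>G\<^esub> ?g \<otimes>\<^bsub>G\<^esub> inv\<^bsub>G\<^esub> h \<otimes>\<^bsub>G\<^esub> inv\<^bsub>G\<^esub> ?g) \<otimes>\<^bsub>G\<^esub> inv\<^bsub>G\<^esub> \<tau> \<in> H"
    by (rule H_conj[OF \<tau>E H_commutator[OF g h]])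
  also have "\<tau> \<otimes>\<^bsub>G\<^esub> (h \<otimes>\<^bsub>G\<^esub> ?g \<otimes>\<^bsub>G\<^esub> inv\<^bsub>G\<^esub> h \<otimes>\<^bsub>G\<^esub> inv\<^bsub>G\<^esub> ?g) \<otimes>\<^bsub>G\<^esub> inv\<^bsub>G\<^esub> \<tau> =
      (\<rho> \<otimes>\<^bsub>G\<^esub> ?g \<otimes>\<^bsub>G\<^esub> inv\<^bsub>G\<^esub> \<rho>) \<otimes>\<^bsub>G\<^esub> inv\<^bsub>G\<^esub> (\<tau> \<otimes>\<^bsub>G\<^esub> ?g \<otimes>\<^bsub>G\<^esub> inv\<^bsub>G\<^esub> \<tau>)"
    by (simp add: h_def G.m_assoc G.inv_mult_group G.inv_cancel)
  finally have xH: "x \<in> H" unfolding \<rho>g \<tau>g x_def .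
  then have xG [simp]: "x \<in> carrier G" by (rule H_carrier)
  have q: "qf (?e j \<oplus>\<^sub>v y) = \<zero>" "bil (?e j \<oplus>\<^sub>v y) (?e (- i)) = \<zero>"
    by (simp_all add: y_def)
  have gG: "eich (?e j) v \<in> carrier G" "eich (?e j \<oplus>\<^sub>v y) (?e (- i)) \<in> carrier G"
    using jv q by (intro eich_closed; simp)+
  have inv_eq: "inv\<^bsub>G\<^esub> (eich (?e j \<oplus>\<^sub>v y) (?e (- i))) = eich (?e j \<oplus>\<^sub>v y) (ax (- i) (\<ominus> \<one>))"
    using q by (subst eich_inv) (simp_all add: l_minus)
  have act_x: "x \<bullet> w = eich (?e j) v \<bullet> eich (?e j \<oplus>\<^sub>v y) (ax (- i) (\<ominus> \<one>)) \<bullet> w" if "w \<in> vecs" for w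
    using that gG act_G_mult[of "eich (?e j) v" "inv\<^bsub>G\<^esub> (eich (?e j \<oplus>\<^sub>v y) (?e (- i)))" w]
    by (simp only: x_def inv_eq[symmetric] G.inv_closed)
  have 1: "eich (?e j \<oplus>\<^sub>v y) (ax (- i) (\<ominus> \<one>)) \<bullet> ?e j = ?e j"
    by (rule vec_eqI) (simp_all add: act_eich y_def minus_eq)
  \<comment> \<open>The entries at -i cancel: the one from -y and the one from <y, e_i> are
    opposite.\<close>
  have 2: "eich (?e j \<oplus>\<^sub>v y) (ax (- i) (\<ominus> \<one>)) \<bullet> ?e i = ax l (\<ominus> c) \<oplus>\<^sub>v ?e i \<oplus>\<^sub>v ax j (\<ominus> \<one>)"
    by (rule vec_eqI) (auto simp add: act_eich y_def minus_eq l_minus r_minus r_neg l_neg)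
  have xj: "x \<bullet> ?e j = ?e j"
    unfolding act_x[OF ax_closed[OF one_closed]] 1
    by (rule vec_eqI) (simp_all add: act_eich vj minus_eq)
  \<comment> \<open>The image of e_i so far has entry zero at -j, so E(e_j, v) adds only a multiple
    of e_j. Its coefficient is irrelevant because E(e_j, a e_j) is trivial.\<close>
  obtain a where a: "a \<in> carrier R" and xi: "x \<bullet> ?e i = ax l (\<ominus> c) \<oplus>\<^sub>v ?e i \<oplus>\<^sub>v ax j a"
  proof
    let ?w = "ax l (\<ominus> c) \<oplus>\<^sub>v ?e i \<oplus>\<^sub>v ax j (\<ominus> \<one>)"
    show "\<ominus> \<one> \<oplus> bil v ?w \<in> carrier R" by simp
    show "x \<bullet> ?e i = ax l (\<ominus> c) \<oplus>\<^sub>v ?e i \<oplus>\<^sub>v ax j (\<ominus> \<one> \<oplus> bil v ?w)"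
      unfolding act_x[OF ax_closed[OF one_closed]] 2
      by (rule vec_eqI) (auto simp: act_eich minus_eq a_ac vj)
  qed
  let ?k = "el j i \<one>"
  have k: "?k \<in> EO R n" by (rule el_EO) simp_all
  \<comment> \<open>Second commutator: x fixes e_j and moves e_i by -c e_l up to a multiple of e_j,
    so exactly \<open>el j l (\<ominus> c)\<close> survives.\<close>
  have "x \<otimes>\<^bsub>G\<^esub> ?k \<otimes>\<^bsub>G\<^esub> inv\<^bsub>G\<^esub> x = eich (?e j) (ax l (\<ominus> c) \<oplus>\<^sub>v ?e i \<oplus>\<^sub>v ax j a)"
    unfolding xi[symmetric] using eich_conj[of x "?e j" "?e i"] by (simp add: el_def xj)
  also have "\<dots> = el j l (\<ominus> c) \<otimes>\<^bsub>G\<^esub> ?k \<otimes>\<^bsub>G\<^esub> eich (?e j) (a \<odot>\<^sub>v ?e j)"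
    using a by (simp add: eich_add el_def)
  also have "eich (?e j) (a \<odot>\<^sub>v ?e j) = \<one>\<^bsub>G\<^esub>" using a by (intro eich_self) simp_all
  finally have "x \<otimes>\<^bsub>G\<^esub> ?k \<otimes>\<^bsub>G\<^esub> inv\<^bsub>G\<^esub> x \<otimes>\<^bsub>G\<^esub> inv\<^bsub>G\<^esub> ?k = el j l (\<ominus> c)"
    by (simp add: G.m_assoc)
  then have "el j l (\<ominus> c) \<in> H" using H_commutator[OF k xH] by simp
  then have "\<ominus> c \<in> level" by (rule level_memI) simp_all
  then have "\<ominus> (\<ominus> c) \<in> level" by (rule additive_subgroup.a_inv_closed[OF ideal.axioms(1)[OF level_ideal]])
  then show ?thesis by (simp add: c_eq)
qed

text \<open>The entries that \<open>entry_in_level\<close> leaves open occur as summands of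
  admissible entries of a conjugate of \<sigma>: position (j, -i) carries \<sigma>(i, -i), and
  position (j, i) carries the difference of diagonal entries. The remaining summands are already in
  the level.\<close>

lemma level_entries:
  assumes \<sigma>: "\<sigma> \<in> H" and ij: "i \<in> Omega n" "j \<in> Omega n"
  shows "i \<noteq> j \<Longrightarrow> \<sigma> (i, j) \<in> level" "\<sigma> (i, i) \<ominus> \<sigma> (j, j) \<in> level"
proof -
  interpret L: ideal level R by (rule level_ideal)
  have \<sigma>G [simp]: "\<sigma> \<in> carrier G" using \<sigma> by (rule H_carrier)
  have cancel: "x \<in> level" if "x \<oplus> y \<in> level" "y \<in> level" "x \<in> carrier R" for x y
  proof -
    have "x \<oplus> y \<oplus> \<ominus> y \<in> level" by (rule L.a_closed[OF that(1) L.a_inv_closed[OF that(2)]])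
    then show ?thesis using that by (simp add: a_assoc r_neg)
  qed
  have key: "\<sigma> (i, - i) \<in> level" "\<sigma> (i, i) \<ominus> \<sigma> (j, j) \<in> level"
    if "i \<in> Omega n" "j \<in> Omega n" "i \<noteq> j" "i \<noteq> - j" for i j
  proof -
    have d: "j \<noteq> i" "j \<noteq> - i" "- i \<noteq> j" "- j \<noteq> i" "i \<noteq> 0" "j \<noteq> 0" using that Omega_nonzero by auto
    note that [simp] d [simp]
    let ?g = "el j (- i) \<one>"
    have g: "?g \<in> EO R n" by (rule el_EO) simp_all
    then have gG [simp]: "?g \<in> carrier G" by (rule EO_carrier)
    define \<sigma>' where "\<sigma>' = ?g \<otimes>\<^bsub>G\<^esub> \<sigma> \<otimes>\<^bsub>G\<^esub> inv\<^bsub>G\<^esub> ?g"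
    have \<sigma>'H: "\<sigma>' \<in> H" unfolding \<sigma>'_def by (rule H_conj[OF g \<sigma>])
    have \<sigma>'G: "\<sigma>' \<in> carrier G" using \<sigma>'H by (rule H_carrier)
    have act: "\<sigma>' \<bullet> w = ?g \<bullet> \<sigma> \<bullet> el j (- i) (\<ominus> \<one>) \<bullet> w" if "w \<in> vecs" for w
      using that el_inv[of j "- i" \<one>] by (simp add: \<sigma>'_def)
    have e1: "el j (- i) (\<ominus> \<one>) \<bullet> ax (- i) \<one> = ax (- i) \<one>"
      by (rule vec_eqI) (simp_all add: act_el)
    have e2: "el j (- i) (\<ominus> \<one>) \<bullet> ax i \<one> = ax i \<one> \<oplus>\<^sub>v ax j (\<ominus> \<one>)"
      by (rule vec_eqI) (simp_all add: act_el)
    have g_j: "(?g \<bullet> w) j = w j \<oplus> w i" if "w \<in> vecs" for w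
      using that by (simp add: act_el)
    have "\<sigma>' (j, - i) = (\<sigma>' \<bullet> ax (- i) \<one>) j" using \<sigma>'G by (simp add: act_ax)
    also have "\<dots> = \<sigma> (i, - i) \<oplus> \<sigma> (j, - i)"
      unfolding act[OF ax_closed[OF one_closed]] e1 by (simp add: g_j act_ax a_comm)
    finally have "\<sigma> (i, - i) \<oplus> \<sigma> (j, - i) \<in> level"
      using entry_in_level[OF \<sigma>'H, of j "- i"] by simp
    then show "\<sigma> (i, - i) \<in> level"
      by (rule cancel) (use entry_in_level[OF \<sigma>, of j "- i"] in simp_all)
    have "\<sigma>' (j, i) = (\<sigma>' \<bullet> ax i \<one>) j" using \<sigma>'G by (simp add: act_ax)
    also have "\<dots> = (\<sigma> (i, i) \<ominus> \<sigma> (j, j)) \<oplus> (\<sigma> (j, i) \<oplus> \<ominus> \<sigma> (i, j))"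
      unfolding act[OF ax_closed[OF one_closed]] e2 by (simp add: g_j act_ax r_minus minus_eq a_ac)
    finally have "(\<sigma> (i, i) \<ominus> \<sigma> (j, j)) \<oplus> (\<sigma> (j, i) \<oplus> \<ominus> \<sigma> (i, j)) \<in> level"
      using entry_in_level[OF \<sigma>'H, of j i] by simp
    then show "\<sigma> (i, i) \<ominus> \<sigma> (j, j) \<in> level"
      by (rule cancel) (auto intro!: L.a_closed L.a_inv_closed entry_in_level \<sigma>)
  qed
  obtain m where m: "m \<in> Omega n" "m \<noteq> i" "m \<noteq> - i" "m \<noteq> j" "m \<noteq> - j"
    using third_index[OF n3] by blast
  have m': "i \<noteq> m" "i \<noteq> - m" "j \<noteq> m" "j \<noteq> - m" using m by auto
  show "\<sigma> (i, j) \<in> level" if "i \<noteq> j"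
    using key(1)[of i m] entry_in_level[OF \<sigma>, of i j] m m' ij that by (cases "i = - j") auto
  \<comment> \<open>Passing through m also covers j = i and j = -i.\<close>
  have "(\<sigma> (i, i) \<ominus> \<sigma> (m, m)) \<oplus> (\<sigma> (m, m) \<ominus> \<sigma> (j, j)) \<in> level"
    using key(2)[of i m] key(2)[of m j] m m' ij by (intro L.a_closed) auto
  also have "(\<sigma> (i, i) \<ominus> \<sigma> (m, m)) \<oplus> (\<sigma> (m, m) \<ominus> \<sigma> (j, j)) = \<sigma> (i, i) \<ominus> \<sigma> (j, j)"
    using ij m by (simp add: minus_eq a_assoc) (simp add: a_assoc[symmetric] l_neg)
  finally show "\<sigma> (i, i) \<ominus> \<sigma> (j, j) \<in> level" .
qed

end

section \<open>The sandwich classification\<close>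

theorem corollary28:
  fixes R :: "('a, 'b) ring_scheme" and n :: nat and H :: "(int \<times> int \<Rightarrow> 'a) set"
  assumes "3 \<le> n"
    and "cring R"
    and "\<one>\<^bsub>R\<^esub> \<noteq> \<zero>\<^bsub>R\<^esub>"
    and "subgroup H (orth_group R n)"
  shows "EO R n \<subseteq> normalizer (orth_group R n) H \<longleftrightarrow>
    (\<exists>I. ideal I R \<and> EO_rel R n I \<subseteq> H \<and> H \<subseteq> CO R n I)"
proof -
  interpret orthogonal R n using assms(2) by (simp add: orthogonal_def)
  have iff: "EO R n \<subseteq> normalizer G H \<longleftrightarrow> (\<forall>g\<in>EO R n. \<forall>h\<in>H. g \<otimes>\<^bsub>G\<^esub> h \<otimes>\<^bsub>G\<^esub> inv\<^bsub>G\<^esub> g \<in> H)"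
    by (rule G.normalizer_iff[OF assms(4) EO_subgroup])
  show ?thesis
  proof
    assume "EO R n \<subseteq> normalizer G H"
    then have conj: "\<forall>g\<in>EO R n. \<forall>h\<in>H. g \<otimes>\<^bsub>G\<^esub> h \<otimes>\<^bsub>G\<^esub> inv\<^bsub>G\<^esub> g \<in> H"
      unfolding iff .
    interpret H: normalized R n H
      by (intro normalized.intro orthogonal_axioms normalized_axioms.intro assms(1,4) conj[rule_format])
    \<comment> \<open>The witness is the level of \<open>H\<close>; both inclusions are then read
      off from transvections and entries.\<close>
    interpret rel: relative R n H.level
      by (intro relative.intro orthogonal_axioms H.level_ideal relative_axioms.intro assms(1))
    have "EO_rel R n H.level \<subseteq> H"
      by (rule rel.N_least[OF assms(4) H.level_el H.H_conj])
    moreover have "H \<subseteq> CO R n H.level"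
    proof
      fix h assume h: "h \<in> H"
      show "h \<in> CO R n H.level"
        unfolding rel.CO_iff[OF H.H_carrier[OF h]] using H.level_entries[OF h] by blast
    qed
    ultimately show "\<exists>I. ideal I R \<and> EO_rel R n I \<subseteq> H \<and> H \<subseteq> CO R n I"
      using H.level_ideal by blast
  next
    assume "\<exists>I. ideal I R \<and> EO_rel R n I \<subseteq> H \<and> H \<subseteq> CO R n I"
    then obtain I where I: "ideal I R" "EO_rel R n I \<subseteq> H" "H \<subseteq> CO R n I" by blast
    interpret rel: relative R n I
      by (intro relative.intro orthogonal_axioms I(1) relative_axioms.intro assms(1))
    show "EO R n \<subseteq> normalizer G H"
      unfolding iff using rel.sandwich_normalized[OF assms(4) I(2,3)] by blast
  qed
qed

end
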